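(* Consider the discrete-time multiple-input multiple-output (MIMO) faster-than-Nyquist (FTN) channel described in the context, with $L$ transmit antennas, $K$ receive antennas, channel matrix $\tilde{H}\in\mathbb{C}^{K\times L}$, raised cosine pulse $g(t)$ with roll-off factor $\beta\in[0,1]$, symbol period $T>0$, acceleration factor $\delta\in(0,1]$, noise level $\sigma_0^2>0$ and power budget $P>0$. Let $\tau_1,\dots,\tau_L\ge 0$ be the eigenvalues of $\tilde{H}^\dagger\tilde{H}$, let $\mu>0$ be the solution of $$\sigma_0^2\sum_{i=1}^{L}\Big(\frac{1}{\mu}-\frac{1}{\tau_i}\Big)^+=P\,\delta T,$$ and set $\bar{\alpha}^{(i)}=\sigma_0^2\big(\frac{1}{\mu}-\frac{1}{\tau_i}\big)^+$ for $i=1,\dots,L$. If $\delta(1+\beta)\ge 1$, then the capacity of this MIMO FTN channel is $$C=\sum_{i=1}^{L}\log_2\!\big(1+\sigma_0^{-2}\bar{\alpha}^{(i)}\tau_i\big)\quad\text{bits per channel use},$$ and, since $1/(\delta T)$ symbols per second are sent over a bandwidth $(1+\beta)/(2T)$, the capacity in bit/s/Hz is $$\bar{C}=\frac{1}{\delta(1+\beta)}\sum_{i=1}^{L}\log_2\!\big(1+\sigma_0^{-2}\bar{\alpha}^{(i)}\tau_i\big).$$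
   Context: Notation: $\dagger$ is conjugate transpose, $\otimes$ the Kronecker product, $I_n$ the $n\times n$ identity, $(a)^+=\max(a,0)$, with the convention $(\frac1\mu-\frac10)^+=0$. The pulse $g(t)$ is a raised cosine pulse, $g(t)=p(t)\star p^*(-t)$ for a unit-energy root raised cosine pulse $p$, with Fourier transform $G(f)=T$ for $|f|\le\frac{1-\beta}{2T}$, $G(f)=\frac{T}{2}\big[1+\cos\big(\frac{\pi T}{\beta}(|f|-\frac{1-\beta}{2T})\big)\big]$ for $\frac{1-\beta}{2T}<|f|\le\frac{1+\beta}{2T}$, and $0$ otherwise. Write $g[n]=g(n\delta T)$ and, for a block length $N$, let $G_N\in\mathbb{C}^{N\times N}$ be the Hermitian Toeplitz matrix with entries $(G_N)_{n,m}=g[n-m]$. Channel model (matched filter outputs at all $K$ receive antennas, sampled every $\delta T$, for $N$ symbols per transmit antenna): $Y=(\tilde{H}\otimes G_N)A+\Omega$, where $A\in\mathbb{C}^{LN}$ stacks the $L$ antennas' symbol vectors, is zero-mean circularly symmetric complex Gaussian with covariance $\Sigma_A$ (an $LN\times LN$ positive semidefinite matrix), and $\Omega$ is independent zero-mean circularly symmetric complex Gaussian noise with covariance $\Sigma_\Omega=\sigma_0^2(I_K\otimes G_N)$. Then $\Sigma_Y=(\tilde{H}\otimes G_N)\Sigma_A(\tilde{H}\otimes G_N)^\dagger+\sigma_0^2(I_K\otimes G_N)$. The transmit power of the FTN signal is $\frac{1}{N\delta T}\mathrm{tr}\big((I_L\otimes G_N)\Sigma_A\big)$ and is constrained to be at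 most $P$. The capacity is defined as $$C=\lim_{N\to\infty}\ \max_{\Sigma_A\succeq 0:\ \frac{1}{N\delta T}\mathrm{tr}((I_L\otimes G_N)\Sigma_A)\le P}\ \frac{1}{N}\log_2\frac{\det\Sigma_Y}{\det\Sigma_\Omega}\quad\text{(bits per channel use)}.$$
   Formalization: Rate 1/(δT) over the stated bandwidth (1+β)/(2T) would give the factor 2/(δ(1+β)), not the displayed 1/(δ(1+β)); the formal statement takes the bit/s/Hz capacity to be C/(δ(1+β)) by definition and does not model symbol rate or bandwidth. *)

theory Defs
  imports "HOL-Analysis.Analysis" "Jordan_Normal_Form.Char_Poly"
begin

definition rc_spectrum :: "real \<Rightarrow> real \<Rightarrow> real \<Rightarrow> real" where
  "rc_spectrum \<beta> T f =
     (if \<bar>f\<bar> \<le> (1 - \<beta>) / (2 * T) then T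
      else if \<bar>f\<bar> \<le> (1 + \<beta>) / (2 * T)
        then T / 2 * (1 + cos (pi * T / \<beta> * (\<bar>f\<bar> - (1 - \<beta>) / (2 * T))))
      else 0)"

definition rc_pulse :: "real \<Rightarrow> real \<Rightarrow> real \<Rightarrow> complex" where
  "rc_pulse \<beta> T t =
     integral UNIV (\<lambda>f. complex_of_real (rc_spectrum \<beta> T f) * exp (\<i> * complex_of_real (2 * pi * f * t)))"

definition toeplitz_G :: "real \<Rightarrow> real \<Rightarrow> real \<Rightarrow> nat \<Rightarrow> complex mat" where
  "toeplitz_G \<beta> T \<delta> N = mat N N (\<lambda>(n, m). rc_pulse \<beta> T ((real n - real m) * \<delta> * T))"

definition kron :: "complex mat \<Rightarrow> complex mat \<Rightarrow> complex mat" where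
  "kron A B = mat (dim_row A * dim_row B) (dim_col A * dim_col B)
     (\<lambda>(i, j). A $$ (i div dim_row B, j div dim_col B) * B $$ (i mod dim_row B, j mod dim_col B))"

definition cadj :: "complex mat \<Rightarrow> complex mat" where
  "cadj A = mat (dim_col A) (dim_row A) (\<lambda>(i, j). cnj (A $$ (j, i)))"

definition mtrace :: "complex mat \<Rightarrow> complex" where
  "mtrace A = (\<Sum>i<dim_row A. A $$ (i, i))"

definition psd_mat :: "nat \<Rightarrow> complex mat \<Rightarrow> bool" where
  "psd_mat n A \<longleftrightarrow> A \<in> carrier_mat n n \<and> cadj A = A \<and>
     (\<forall>v \<in> carrier_vec n. 0 \<le> Re (\<Sum>i<n. \<Sum>j<n. cnj (v $ i) * A $$ (i, j) * v $ j))"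

definition Sigma_Omega :: "nat \<Rightarrow> real \<Rightarrow> real \<Rightarrow> real \<Rightarrow> real \<Rightarrow> nat \<Rightarrow> complex mat" where
  "Sigma_Omega K \<beta> T \<delta> \<sigma>0 N = complex_of_real (\<sigma>0\<^sup>2) \<cdot>\<^sub>m kron (1\<^sub>m K) (toeplitz_G \<beta> T \<delta> N)"

definition Sigma_Y :: "complex mat \<Rightarrow> real \<Rightarrow> real \<Rightarrow> real \<Rightarrow> real \<Rightarrow> nat \<Rightarrow> complex mat \<Rightarrow> complex mat" where
  "Sigma_Y H \<beta> T \<delta> \<sigma>0 N SA =
     kron H (toeplitz_G \<beta> T \<delta> N) * SA * cadj (kron H (toeplitz_G \<beta> T \<delta> N))
     + Sigma_Omega (dim_row H) \<beta> T \<delta> \<sigma>0 N"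

definition tx_power :: "nat \<Rightarrow> real \<Rightarrow> real \<Rightarrow> real \<Rightarrow> nat \<Rightarrow> complex mat \<Rightarrow> real" where
  "tx_power L \<beta> T \<delta> N SA = Re (mtrace (kron (1\<^sub>m L) (toeplitz_G \<beta> T \<delta> N) * SA)) / (real N * \<delta> * T)"

definition block_capacity ::
  "complex mat \<Rightarrow> real \<Rightarrow> real \<Rightarrow> real \<Rightarrow> real \<Rightarrow> real \<Rightarrow> nat \<Rightarrow> real" where
  "block_capacity H \<beta> T \<delta> \<sigma>0 P N =
     (SUP SA \<in> {SA. psd_mat (dim_col H * N) SA \<and> tx_power (dim_col H) \<beta> T \<delta> N SA \<le> P}.
        1 / real N * log 2 (Re (det (Sigma_Y H \<beta> T \<delta> \<sigma>0 N SA))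
                           / Re (det (Sigma_Omega (dim_row H) \<beta> T \<delta> \<sigma>0 N))))"

text \<open>Water-filling term (1/mu - 1/tau)^+ with the convention (1/mu - 1/0)^+ = 0.\<close>
definition wf_pos :: "real \<Rightarrow> real \<Rightarrow> real" where
  "wf_pos \<mu> \<tau> = (if \<tau> = 0 then 0 else max (1 / \<mu> - 1 / \<tau>) 0)"

end

theory Submission
  imports Defs "Jordan_Normal_Form.Schur_Decomposition"
begin

text \<open>For every \<open>N \<ge> 1\<close> the matrix \<open>G\<^sub>N\<close> is Hermitian positive definite: its quadratic form is the integral of
  the raised cosine spectrum against \<open>|p|\<^sup>2\<close> for a trigonometric polynomial \<open>p\<close>, which cannot vanish on an
  interval. Hence the factor \<open>G\<^sub>N\<close> can be absorbed into the input covariance, and the block problem is \<open>N\<close>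
  copies of the classical MIMO water-filling problem for \<open>H\<close>: the block capacity equals the limit exactly, for
  every \<open>N \<ge> 1\<close>. Optimality of the water-filling covariance
  \<open>S\<^sub>0 = (U diag(\<alpha>) U\<^sup>*) \<otimes> G\<^sub>N\<^sup>-\<^sup>1\<close> follows from the concavity of \<open>ln det\<close>: with \<open>Q\<close> the received covariance
  at \<open>S\<^sub>0\<close>, every received covariance \<open>M\<close> satisfies \<open>det M \<le> det Q * exp (tr (Q\<^sup>-\<^sup>1 M) - KN)\<close>, and the
  optimality conditions make the exponent nonpositive.\<close>

subsection \<open>Adjoint and trace\<close>

text \<open>An arbitrary input covariance \<open>S\<close> need not be a Kronecker product, so no
  diagonalisation of the received covariance is at hand. The tangent bound avoids the problem: it
  only involves the trace of the received covariance against one fixed inverse,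
  \<open>kron Ri Gi\<close>, and this is affine in \<open>S\<close>. Its signal part can be compared
  with the power because both functionals carry the same factor \<open>G\<close>: one is
  \<open>mtrace (kron (cadj H * Ri * H) G * S)\<close>, the other
  \<open>mtrace (kron (1\<^sub>m L) G * S)\<close>. What remains is a comparison of L x L matrices
  that are diagonal in the basis \<open>U\<close>, that is, the scalar inequalities
  \<open>\<tau> i / (s + \<alpha> i * \<tau> i) \<le> c\<close>. For the water-filling powers the
  multiplier is \<open>c = \<mu> / s\<close>, with equality wherever \<open>\<alpha> i\<close> is
  positive.\<close>

lemma mult_assoc_dim:
  "dim_col A = dim_row B \<Longrightarrow> dim_col B = dim_row C \<Longrightarrow> A * B * C = A * (B * (C :: complex mat))"
  by (rule assoc_mult_mat[of A "dim_row A" "dim_row B" B "dim_row C" C "dim_col C"])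
    (rule carrier_matI; simp)+

lemma mult_index_sum:
  "i < dim_row A \<Longrightarrow> j < dim_col B \<Longrightarrow> dim_col A = dim_row B \<Longrightarrow>
    (A * B) $$ (i, j) = (\<Sum>k<dim_row B. A $$ (i, k) * B $$ (k, j))"
  by (simp add: scalar_prod_def atLeast0LessThan)

lemma cadj_dim [simp]: "dim_row (cadj A) = dim_col A" "dim_col (cadj A) = dim_row A"
  by (simp_all add: cadj_def)

lemma cadj_carrier: "A \<in> carrier_mat n m \<Longrightarrow> cadj A \<in> carrier_mat m n"
  by auto

lemma cadj_index [simp]:
  "i < dim_col A \<Longrightarrow> j < dim_row A \<Longrightarrow> cadj A $$ (i, j) = cnj (A $$ (j, i))"
  by (simp add: cadj_def)

lemma cadj_cadj [simp]: "cadj (cadj A) = A"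
  by (rule eq_matI) auto

lemma cadj_mult: "dim_col A = dim_row B \<Longrightarrow> cadj (A * B) = cadj B * cadj A"
  by (rule eq_matI) (auto simp: mult_index_sum mult.commute simp del: index_mult_mat(1))

lemma cadj_add:
  "dim_row A = dim_row B \<Longrightarrow> dim_col A = dim_col B \<Longrightarrow> cadj (A + B) = cadj A + cadj B"
  by (rule eq_matI) auto

lemma cadj_one [simp]: "cadj (1\<^sub>m n) = 1\<^sub>m n"
  by (rule eq_matI) auto

lemma cadj_mat_diag: "cadj (mat_diag n f) = mat_diag n (\<lambda>i. cnj (f i))"
  by (rule eq_matI) (auto simp: mat_diag_def)

lemma mat_diag_dims [simp]: "dim_row (mat_diag n f) = n" "dim_col (mat_diag n f) = n"
  by (auto simp: mat_diag_def)

lemma det_cadj: assumes "A \<in> carrier_mat n n" shows "det (cadj A) = cnj (det A)"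
proof -
  interpret comm_ring_hom cnj
    by standard auto
  have "cadj A = map_mat cnj (transpose_mat A)"
    by (rule eq_matI) (use assms in auto)
  then show ?thesis
    using assms det_transpose[OF assms] by simp
qed

lemma mtrace_mult_commute:
  assumes "A \<in> carrier_mat n m" "B \<in> carrier_mat m n"
  shows "mtrace (A * B) = mtrace (B * A)"
proof -
  have "mtrace (A * B) = (\<Sum>i<n. \<Sum>k<m. A $$ (i, k) * B $$ (k, i))"
    using assms by (simp add: mtrace_def mult_index_sum del: index_mult_mat(1))
  also have "\<dots> = (\<Sum>k<m. \<Sum>i<n. B $$ (k, i) * A $$ (i, k))"
    by (subst sum.swap) (simp add: mult.commute)
  also have "\<dots> = mtrace (B * A)"
    using assms by (simp add: mtrace_def mult_index_sum del: index_mult_mat(1))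
  finally show ?thesis .
qed

lemma mtrace_add:
  "A \<in> carrier_mat n n \<Longrightarrow> B \<in> carrier_mat n n \<Longrightarrow> mtrace (A + B) = mtrace A + mtrace B"
  by (simp add: mtrace_def sum.distrib)

lemma mtrace_minus:
  "A \<in> carrier_mat n n \<Longrightarrow> B \<in> carrier_mat n n \<Longrightarrow> mtrace (A - B) = mtrace A - mtrace B"
  by (simp add: mtrace_def sum_subtractf)

lemma mtrace_smult: "A \<in> carrier_mat n n \<Longrightarrow> mtrace (c \<cdot>\<^sub>m A) = c * mtrace A"
  by (simp add: mtrace_def sum_distrib_left)

lemma mtrace_one: "mtrace (1\<^sub>m n) = of_nat n"
  by (simp add: mtrace_def)

lemma mtrace_mat_diag: "mtrace (mat_diag n f) = (\<Sum>i<n. f i)"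
  by (simp add: mtrace_def mat_diag_def)

subsection \<open>Kronecker products\<close>

text \<open>The pairs \<open>(k div b, k mod b)\<close> with \<open>k < a * b\<close> meet every
  index pair exactly once; this is the row and column indexing of \<open>kron\<close>.\<close>

lemma sum_div_mod:
  fixes f :: "nat \<Rightarrow> nat \<Rightarrow> 'a :: comm_monoid_add"
  shows "(\<Sum>k<a * b. f (k div b) (k mod b)) = (\<Sum>i<a. \<Sum>j<b. f i j)"
proof (cases "b = 0")
  case False
  have "(\<Sum>k<a * b. f (k div b) (k mod b))
    = (\<Sum>i<a. \<Sum>k=i*b..<i*b+b. f (k div b) (k mod b))"
    by (rule sum.nat_group[symmetric])
  also have "\<dots> = (\<Sum>i<a. \<Sum>j<b. f i j)"
  proof (rule sum.cong[OF refl])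
    fix i assume "i \<in> {..<a}"
    have "(\<Sum>k=i*b..<i*b+b. f (k div b) (k mod b))
      = (\<Sum>k=0+i*b..<b+i*b. f (k div b) (k mod b))"
      by (simp add: add.commute)
    also have "\<dots> = (\<Sum>j=0..<b. f i j)"
      using False by (subst sum.shift_bounds_nat_ivl) simp
    finally show "(\<Sum>k=i*b..<i*b+b. f (k div b) (k mod b)) = (\<Sum>j<b. f i j)"
      by (simp add: atLeast0LessThan)
  qed
  finally show ?thesis .
qed simp

lemma kron_dim [simp]:
  "dim_row (kron A B) = dim_row A * dim_row B" "dim_col (kron A B) = dim_col A * dim_col B"
  by (simp_all add: kron_def)

lemma kron_carrier:
  "A \<in> carrier_mat a b \<Longrightarrow> B \<in> carrier_mat c d \<Longrightarrow> kron A B \<in> carrier_mat (a * c) (b * d)"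
  by auto

lemma kron_index [simp]:
  "i < dim_row A * dim_row B \<Longrightarrow> j < dim_col A * dim_col B \<Longrightarrow>
   kron A B $$ (i, j) = A $$ (i div dim_row B, j div dim_col B) * B $$ (i mod dim_row B, j mod dim_col B)"
  by (simp add: kron_def)

lemma div_mod_less_mult: "i < a * b \<Longrightarrow> i div b < a" "i < a * b \<Longrightarrow> i mod b < (b :: nat)"
  by (auto simp: less_mult_imp_div_less) (metis mod_less_divisor mult_0_right neq0_conv not_less0)

lemma kron_mult:
  assumes "dim_col A = dim_row C" "dim_col B = dim_row D"
  shows "kron A B * kron C D = kron (A * C) (B * D)"
proof (rule eq_matI)
  fix i j assume "i < dim_row (kron (A * C) (B * D))" "j < dim_col (kron (A * C) (B * D))"
  then have i: "i < dim_row A * dim_row B" and j: "j < dim_col C * dim_col D" by auto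
  note ij = div_mod_less_mult[OF i] div_mod_less_mult[OF j]
  have "(kron A B * kron C D) $$ (i, j) = (\<Sum>k<dim_row C * dim_row D.
      (A $$ (i div dim_row B, k div dim_row D) * C $$ (k div dim_row D, j div dim_col D)) *
      (B $$ (i mod dim_row B, k mod dim_row D) * D $$ (k mod dim_row D, j mod dim_col D)))"
    using i j assms by (subst mult_index_sum) (auto intro!: sum.cong)
  also have "\<dots> = (\<Sum>k<dim_row C. \<Sum>l<dim_row D.
      (A $$ (i div dim_row B, k) * C $$ (k, j div dim_col D)) *
      (B $$ (i mod dim_row B, l) * D $$ (l, j mod dim_col D)))"
    by (rule sum_div_mod[where f = "\<lambda>k l. (A $$ (i div dim_row B, k) * C $$ (k, j div dim_col D)) *
      (B $$ (i mod dim_row B, l) * D $$ (l, j mod dim_col D))"])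
  also have "\<dots> = kron (A * C) (B * D) $$ (i, j)"
    using i j ij assms by (simp add: mult_index_sum sum_product del: index_mult_mat(1))
  finally show "(kron A B * kron C D) $$ (i, j) = kron (A * C) (B * D) $$ (i, j)" .
qed auto

lemma cadj_kron: "cadj (kron A B) = kron (cadj A) (cadj B)"
  by (rule eq_matI) (auto simp: div_mod_less_mult)

lemma kron_mat_diag_one: "kron (mat_diag a f) (1\<^sub>m b) = mat_diag (a * b) (\<lambda>i. f (i div b))"
proof (rule eq_matI)
  fix i j assume "i < dim_row (mat_diag (a * b) (\<lambda>i. f (i div b)))"
    "j < dim_col (mat_diag (a * b) (\<lambda>i. f (i div b)))"
  then have ij: "i < a * b" "j < a * b" by auto
  have "i = j \<longleftrightarrow> i div b = j div b \<and> i mod b = j mod b"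
    by (metis div_mult_mod_eq)
  then show "kron (mat_diag a f) (1\<^sub>m b) $$ (i, j) = mat_diag (a * b) (\<lambda>i. f (i div b)) $$ (i, j)"
    using ij div_mod_less_mult[OF ij(1)] div_mod_less_mult[OF ij(2)]
    by (auto simp: mat_diag_def)
qed auto

lemma kron_one_one: "kron (1\<^sub>m a) (1\<^sub>m b) = 1\<^sub>m (a * b)"
  using kron_mat_diag_one[of a "\<lambda>_. 1" b] by simp

lemma kron_add_left:
  "dim_row A = dim_row B \<Longrightarrow> dim_col A = dim_col B \<Longrightarrow> kron (A + B) C = kron A C + kron B C"
  by (rule eq_matI) (auto simp: div_mod_less_mult algebra_simps)

lemma kron_smult_left: "kron (c \<cdot>\<^sub>m A) C = c \<cdot>\<^sub>m kron A C"
  by (rule eq_matI) (auto simp: div_mod_less_mult algebra_simps)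

lemma mtrace_kron:
  assumes "A \<in> carrier_mat a a" "B \<in> carrier_mat b b"
  shows "mtrace (kron A B) = mtrace A * mtrace B"
  using assms sum_div_mod[where f = "\<lambda>i j. A $$ (i, i) * B $$ (j, j)" and a = a and b = b]
  by (simp add: mtrace_def sum_product)

lemma det_mat_diag: "det (mat_diag n f) = (\<Prod>i<n. f i)"
proof -
  have "det (mat_diag n f) = prod_list (diag_mat (mat_diag n f))"
    by (rule det_upper_triangular[of _ n]) (auto simp: mat_diag_def upper_triangular_def)
  also have "diag_mat (mat_diag n f) = map f [0..<n]"
    by (auto simp: diag_mat_def mat_diag_def)
  also have "prod_list \<dots> = (\<Prod>i<n. f i)"
    by (metis prod.distinct_set_conv_list distinct_upt atLeast0LessThan set_upt)
  finally show ?thesis .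
qed

lemma prod_div:
  fixes f :: "nat \<Rightarrow> 'a :: comm_monoid_mult"
  shows "(\<Prod>k<a * b. f (k div b)) = (\<Prod>i<a. f i ^ b)"
proof (cases "b = 0")
  case False
  have "(\<Prod>k<a * b. f (k div b)) = (\<Prod>i<a. \<Prod>k=i*b..<i*b+b. f (k div b))"
    by (rule prod.nat_group[symmetric])
  also have "\<dots> = (\<Prod>i<a. f i ^ b)"
  proof (rule prod.cong[OF refl])
    fix i assume "i \<in> {..<a}"
    have "(\<Prod>k=i*b..<i*b+b. f (k div b)) = (\<Prod>k=i*b..<i*b+b. f i)"
      by (rule prod.cong) (auto intro!: arg_cong[of _ _ f] simp: div_nat_eqI mult.commute)
    then show "(\<Prod>k=i*b..<i*b+b. f (k div b)) = f i ^ b" by simp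
  qed
  finally show ?thesis .
qed simp

lemma det_kron_mat_diag_one: "det (kron (mat_diag a f) (1\<^sub>m b)) = (\<Prod>i<a. f i) ^ b"
  by (simp add: kron_mat_diag_one det_mat_diag prod_div prod_power_distrib)

subsection \<open>Sylvester's determinant identity\<close>

text \<open>Moves a determinant from the K-dimensional receive side to the L-dimensional transmit
  side, where the diagonalisation of \<open>cadj H * H\<close> applies.\<close>

lemma sylvester_det:
  fixes A B :: "complex mat"
  assumes A: "A \<in> carrier_mat m n" and B: "B \<in> carrier_mat n m"
  shows "det (1\<^sub>m m + A * B) = det (1\<^sub>m n + B * A)"
proof -
  \<comment> \<open>Chosen so that \<open>?X * ?Y\<close> and \<open>?Y * ?X\<close> are both block
    lower triangular; each order exposes one of the two determinants.\<close>
  let ?X = "four_block_mat (1\<^sub>m m) (- A) B (1\<^sub>m n)"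
  let ?Y = "four_block_mat (1\<^sub>m m) A (0\<^sub>m n m) (1\<^sub>m n)"
  have X: "?X \<in> carrier_mat (m + n) (m + n)" and Y: "?Y \<in> carrier_mat (m + n) (m + n)"
    using A B by auto
  have "?X * ?Y = four_block_mat (1\<^sub>m m * 1\<^sub>m m + - A * 0\<^sub>m n m) (1\<^sub>m m * A + - A * 1\<^sub>m n)
      (B * 1\<^sub>m m + 1\<^sub>m n * 0\<^sub>m n m) (B * A + 1\<^sub>m n * 1\<^sub>m n)"
    by (rule mult_four_block_mat) (use A B in auto)
  also have "\<dots> = four_block_mat (1\<^sub>m m) (0\<^sub>m m n) B (1\<^sub>m n + B * A)"
    using A B by (intro arg_cong4[where f = four_block_mat]) (auto simp: comm_add_mat)
  finally have 1: "det (?X * ?Y) = det (1\<^sub>m n + B * A)"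
    using A B by (simp add: det_four_block_mat_upper_right_zero[of _ m _ n])
  have "?Y * ?X = four_block_mat (1\<^sub>m m * 1\<^sub>m m + A * B) (1\<^sub>m m * - A + A * 1\<^sub>m n)
      (0\<^sub>m n m * 1\<^sub>m m + 1\<^sub>m n * B) (0\<^sub>m n m * - A + 1\<^sub>m n * 1\<^sub>m n)"
    by (rule mult_four_block_mat) (use A B in auto)
  also have "\<dots> = four_block_mat (1\<^sub>m m + A * B) (0\<^sub>m m n) B (1\<^sub>m n)"
    using A B by (intro arg_cong4[where f = four_block_mat]) auto
  finally have 2: "det (?Y * ?X) = det (1\<^sub>m m + A * B)"
    using A B by (simp add: det_four_block_mat_upper_right_zero[of _ m _ n])
  show ?thesis
    using 1 2 unfolding det_mult[OF X Y] det_mult[OF Y X] by (simp only: mult.commute[of "det ?Y"])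
qed

subsection \<open>Spectral theorem for Hermitian matrices\<close>

text \<open>Completing \<open>v\<close> to a basis and orthonormalising keeps the direction of
  \<open>v\<close> in column 0. Used with an eigenvector \<open>v\<close>, it provides the deflation
  step of the spectral theorem.\<close>

lemma unitary_with_first_column:
  fixes v :: "complex vec"
  assumes v: "v \<in> carrier_vec n" and v0: "v \<noteq> 0\<^sub>v n"
  shows "\<exists>U c. U \<in> carrier_mat n n \<and> cadj U * U = 1\<^sub>m n \<and> (\<forall>k<n. U $$ (k, 0) = c * v $ k)"
proof -
  interpret cof_vec_space n "TYPE(complex)" .
  define b where "b = basis_completion v"
  define ws where "ws = gram_schmidt n b"
  from basis_completion[OF v v0, folded b_def]
  have b: "distinct b" "\<not> lin_dep (set b)" "set b \<subseteq> carrier_vec n" "hd b = v" "length b = n"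
    by auto
  from v v0 have "n \<noteq> 0" by auto
  with b obtain vs where bv: "b = v # vs" by (cases b) auto
  have ws: "set ws \<subseteq> carrier_vec n" "corthogonal ws" "length ws = n"
    using gram_schmidt_result[OF b(3,1,2) ws_def] b(5) by auto
  have "hd ws = v"
    using gram_schmidt_hd[OF v, of vs] by (simp add: ws_def bv)
  then have ws0: "ws ! 0 = v"
    using ws \<open>n \<noteq> 0\<close> by (metis hd_conv_nth length_0_conv)
  \<comment> \<open>Gram-Schmidt as used here only orthogonalises; dividing by the norms
    \<open>r j\<close> makes the columns orthonormal.\<close>
  define r where "r j = sqrt (\<Sum>k<n. (cmod (ws ! j $ k))\<^sup>2)" for j
  define U where "U = mat n n (\<lambda>(k, j). ws ! j $ k / complex_of_real (r j))"
  have wsc: "ws ! j \<in> carrier_vec n" if "j < n" for j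
    using ws that by auto
  have ip: "ws ! j \<bullet>c ws ! i = (\<Sum>k<n. cnj (ws ! i $ k) * ws ! j $ k)" if "i < n" "j < n" for i j
    using wsc[OF that(1)] wsc[OF that(2)]
    by (auto simp: scalar_prod_def atLeast0LessThan mult.commute intro!: sum.cong)
  have ip_self: "ws ! j \<bullet>c ws ! j = complex_of_real ((r j)\<^sup>2)" if "j < n" for j
    by (simp add: ip[OF that that] r_def sum_nonneg complex_norm_square mult.commute del: of_real_power)
  have "cadj U * U = 1\<^sub>m n"
  proof (rule eq_matI)
    fix i j assume "i < dim_row (1\<^sub>m n :: complex mat)" "j < dim_col (1\<^sub>m n :: complex mat)"
    then have ij: "i < n" "j < n" by auto
    have "(cadj U * U) $$ (i, j)
      = (\<Sum>k<n. cnj (ws ! i $ k) * ws ! j $ k / (complex_of_real (r i) * complex_of_real (r j)))"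
      using ij by (subst mult_index_sum) (auto simp: U_def intro!: sum.cong)
    also have "\<dots> = (ws ! j \<bullet>c ws ! i) / (complex_of_real (r i) * complex_of_real (r j))"
      by (simp add: ip[OF ij] sum_divide_distrib)
    also have "\<dots> = (if i = j then 1 else 0)"
    proof (cases "i = j")
      case True
      \<comment> \<open>\<open>corthogonal\<close> says that the inner product vanishes exactly for
        distinct indices, so it also excludes zero vectors and the division by \<open>r j\<close> is
        harmless.\<close>
      have "ws ! j \<bullet>c ws ! j \<noteq> 0"
        using corthogonalD[OF ws(2), of j j] ij ws(3) by simp
      then show ?thesis
        using True ij by (simp add: ip_self power2_eq_square)
    next
      case False
      then have "ws ! j \<bullet>c ws ! i = 0"
        using corthogonalD[OF ws(2), of j i] ij ws(3) by simp
      with False show ?thesis by simp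
    qed
    finally show "(cadj U * U) $$ (i, j) = 1\<^sub>m n $$ (i, j)"
      using ij by simp
  qed (auto simp: U_def)
  moreover have "\<forall>k<n. U $$ (k, 0) = (1 / complex_of_real (r 0)) * v $ k"
    using \<open>n \<noteq> 0\<close> by (simp add: U_def ws0)
  moreover have "U \<in> carrier_mat n n" by (simp add: U_def)
  ultimately show ?thesis by blast
qed

lemma unitary_right_inverse:
  assumes "U \<in> carrier_mat n n" "cadj U * U = 1\<^sub>m n"
  shows "U * cadj U = 1\<^sub>m n"
  by (rule mat_mult_left_right_inverse[OF cadj_carrier[OF assms(1)] assms])

lemma block_diag_mult:
  fixes A A' B B' :: "complex mat"
  assumes A: "A \<in> carrier_mat a a" and A': "A' \<in> carrier_mat a a"
    and B: "B \<in> carrier_mat b b" and B': "B' \<in> carrier_mat b b"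
  shows "four_block_mat A (0\<^sub>m a b) (0\<^sub>m b a) B * four_block_mat A' (0\<^sub>m a b) (0\<^sub>m b a) B'
    = four_block_mat (A * A') (0\<^sub>m a b) (0\<^sub>m b a) (B * B')"
proof -
  have "A * A' + 0\<^sub>m a b * 0\<^sub>m b a = A * A'" "A * 0\<^sub>m a b + 0\<^sub>m a b * B' = 0\<^sub>m a b"
    "0\<^sub>m b a * A' + B * 0\<^sub>m b a = 0\<^sub>m b a" "0\<^sub>m b a * 0\<^sub>m a b + B * B' = B * B'"
    using assms by (simp_all add: left_add_zero_mat[of _ a a] right_add_zero_mat[of _ a a] left_add_zero_mat[of _ b b])
  with mult_four_block_mat[OF A zero_carrier_mat zero_carrier_mat B A' zero_carrier_mat zero_carrier_mat B']
  show ?thesis by simp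
qed

text \<open>The list of eigenvalues is prescribed and its order is kept, so that the diagonal can be
  matched index by index with the list given in the final theorem. The proof is by deflation: in an
  orthonormal basis that starts with an eigenvector for \<open>e\<close>, a Hermitian matrix splits
  into \<open>e\<close> and a smaller Hermitian block.\<close>

theorem hermitian_spectral:
  fixes A :: "complex mat"
  assumes "A \<in> carrier_mat n n" "cadj A = A" "char_poly A = (\<Prod>a\<leftarrow>es. [:- a, 1:])"
  shows "\<exists>U \<in> carrier_mat n n. cadj U * U = 1\<^sub>m n \<and> A = U * mat_diag n (\<lambda>i. es ! i) * cadj U"
  using assms
proof (induction es arbitrary: n A)
  case Nil
  then have "n = 0"
    using degree_monic_char_poly[of A n] by simp
  with Nil show ?case
    by (intro bexI[of _ "1\<^sub>m 0"]) auto
next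
  case (Cons e es)
  note A = Cons.prems(1)
  have mon: "monic (\<Prod>a\<leftarrow>es. [:- a, 1:])" by (rule monic_prod_list) auto
  have "degree (char_poly A) = Suc (degree (\<Prod>a\<leftarrow>es. [:- a, 1:]))"
    unfolding Cons.prems(3) list.map prod_list.Cons
    by (subst degree_mult_eq) (use mon in auto)
  \<comment> \<open>Written as \<open>1 + m\<close> to agree with the dimensions of the block
    matrices below.\<close>
  then obtain m where n: "n = 1 + m"
    using degree_monic_char_poly[OF A] by auto
  then have n0: "0 < n" by simp
  have "eigenvalue A e"
    unfolding eigenvalue_root_char_poly[OF A] Cons.prems(3) by simp
  then obtain v where v: "v \<in> carrier_vec n" "v \<noteq> 0\<^sub>v n" "A *\<^sub>v v = e \<cdot>\<^sub>v v"
    using A unfolding eigenvalue_def eigenvector_def by auto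
  obtain U c where U: "U \<in> carrier_mat n n" "cadj U * U = 1\<^sub>m n"
    and U0: "\<And>k. k < n \<Longrightarrow> U $$ (k, 0) = c * v $ k"
    using unitary_with_first_column[OF v(1,2)] by blast
  note UU = unitary_right_inverse[OF U]
  define A' where "A' = cadj U * (A * U)"
  have A': "A' \<in> carrier_mat n n" using A U by (auto simp: A'_def)
  note dims [simp] = carrier_matD[OF A] carrier_matD[OF U(1)] carrier_matD[OF A']
  have A_eq: "A = U * (A' * cadj U)"
  proof -
    have "U * (A' * cadj U) = (U * cadj U) * A * (U * cadj U)"
      by (simp add: A'_def mult_assoc_dim)
    then show ?thesis using A by (simp add: UU)
  qed
  have "cadj A' = A'"
    by (simp add: A'_def cadj_mult mult_assoc_dim Cons.prems(2))
  then have herm: "A' $$ (i, j) = cnj (A' $$ (j, i))" if "i < n" "j < n" for i j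
    using that by (metis cadj_index dims(5,6))
  have AU0: "(A * U) $$ (k, 0) = e * U $$ (k, 0)" if "k < n" for k
  proof -
    have "(A * U) $$ (k, 0) = (\<Sum>l<n. A $$ (k, l) * (c * v $ l))"
      using that by (subst mult_index_sum) (auto simp: n U0 intro!: sum.cong)
    also have "\<dots> = c * (A *\<^sub>v v) $ k"
      using that v(1) by (auto simp: scalar_prod_def atLeast0LessThan sum_distrib_left ac_simps intro!: sum.cong)
    finally show ?thesis
      using that v by (simp add: U0)
  qed
  \<comment> \<open>Column 0 of \<open>U\<close> is an eigenvector and the columns are orthonormal,
    so column 0 of \<open>A'\<close> is \<open>e\<close> times the first unit vector.\<close>
  have col0: "A' $$ (i, 0) = (if i = 0 then e else 0)" if "i < n" for i
  proof -
    have "A' $$ (i, 0) = (\<Sum>k<n. cadj U $$ (i, k) * (e * U $$ (k, 0)))"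
      using that unfolding A'_def by (subst mult_index_sum) (auto simp: n AU0 simp del: index_mult_mat(1) intro!: sum.cong)
    also have "\<dots> = e * (cadj U * U) $$ (i, 0)"
      using that n0 by (subst mult_index_sum) (simp_all add: sum_distrib_left mult.assoc mult.left_commute)
    finally show ?thesis
      using that by (simp add: U(2) n)
  qed
  define A3 where "A3 = mat m m (\<lambda>(i, j). A' $$ (Suc i, Suc j))"
  have A3: "A3 \<in> carrier_mat m m" by (simp add: A3_def)
  \<comment> \<open>Hermitian symmetry carries the zeros of column 0 over to row 0.\<close>
  have A'_block: "A' = four_block_mat (mat 1 1 (\<lambda>_. e)) (0\<^sub>m 1 m) (0\<^sub>m m 1) A3"
  proof (rule eq_matI)
    fix i j
    assume "i < dim_row (four_block_mat (mat 1 1 (\<lambda>_. e)) (0\<^sub>m 1 m) (0\<^sub>m m 1) A3)"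
      "j < dim_col (four_block_mat (mat 1 1 (\<lambda>_. e)) (0\<^sub>m 1 m) (0\<^sub>m m 1) A3)"
    then have ij: "i < n" "j < n" by (auto simp: n A3_def)
    then show "A' $$ (i, j) = four_block_mat (mat 1 1 (\<lambda>_. e)) (0\<^sub>m 1 m) (0\<^sub>m m 1) A3 $$ (i, j)"
      using col0[OF ij(1)] col0[OF ij(2)] herm[OF ij] by (cases i; cases j) (auto simp: n A3_def)
  qed (auto simp: n A3_def)
  \<comment> \<open>Similarity and the block form let the factor for \<open>e\<close> cancel from
    the characteristic polynomial, so the induction hypothesis applies to \<open>A3\<close> with the
    rest of the list.\<close>
  have "similar_mat_wit A' A (cadj U) U"
    by (rule similar_mat_witI[OF U(2) UU _ A' A cadj_carrier[OF U(1)] U(1)])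
      (simp add: A'_def mult_assoc_dim)
  then have "char_poly A' = char_poly A"
    by (intro char_poly_similar) (auto simp: similar_mat_def)
  moreover have "char_poly A' = [:- e, 1:] * char_poly A3"
    unfolding A'_block
    by (subst char_poly_four_block_zeros_col[OF _ _ A3])
      (auto simp: char_poly_defs Determinant.det_def sign_def)
  ultimately have "char_poly A3 = (\<Prod>a\<leftarrow>es. [:- a, 1:])"
    unfolding Cons.prems(3) list.map prod_list.Cons
    by (metis mult_cancel_left pCons_eq_0_iff zero_neq_one)
  moreover have "cadj A3 = A3"
    by (rule eq_matI) (auto simp: A3_def n herm[symmetric])
  ultimately obtain U3 where U3: "U3 \<in> carrier_mat m m" "cadj U3 * U3 = 1\<^sub>m m"
    and A3_eq: "A3 = U3 * mat_diag m (\<lambda>i. es ! i) * cadj U3"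
    using Cons.IH[OF A3] by blast
  note dims3 [simp] = carrier_matD[OF U3(1)]
  \<comment> \<open>\<open>F\<close> fixes the eigenvector already found and diagonalises the
    remaining block; \<open>U * F\<close> is the required unitary matrix.\<close>
  define F where "F = four_block_mat (1\<^sub>m 1) (0\<^sub>m 1 m) (0\<^sub>m m 1) U3"
  have F: "F \<in> carrier_mat n n" 
    unfolding F_def n by (rule four_block_carrier_mat) (use U3 in auto)
  note dimsF [simp] = carrier_matD[OF F]
  have cF: "cadj F = four_block_mat (1\<^sub>m 1) (0\<^sub>m 1 m) (0\<^sub>m m 1) (cadj U3)"
    by (rule eq_matI) (auto simp: F_def)
  have FF: "cadj F * F = 1\<^sub>m n"
    unfolding cF unfolding F_def block_diag_mult[OF one_carrier_mat one_carrier_mat cadj_carrier[OF U3(1)] U3(1)]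
    by (simp add: U3(2) n)
  define D where "D = mat_diag n (\<lambda>i. (e # es) ! i)"
  let ?E = "mat 1 1 (\<lambda>_. e)"
  let ?D3 = "mat_diag m (\<lambda>i. es ! i)"
  have E: "?E \<in> carrier_mat 1 1" by simp
  have D_block: "D = four_block_mat ?E (0\<^sub>m 1 m) (0\<^sub>m m 1) ?D3"
    by (rule eq_matI) (auto simp: D_def n mat_diag_def nth_Cons')
  have "F * D = four_block_mat ?E (0\<^sub>m 1 m) (0\<^sub>m m 1) (U3 * ?D3)"
    unfolding F_def D_block block_diag_mult[OF one_carrier_mat E U3(1) mat_diag_dim]
    using E by simp
  moreover have "four_block_mat ?E (0\<^sub>m 1 m) (0\<^sub>m m 1) (U3 * ?D3) * cadj F = A'"
    unfolding cF A'_block A3_eq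
      block_diag_mult[OF E one_carrier_mat mult_carrier_mat[OF U3(1) mat_diag_dim] cadj_carrier[OF U3(1)]]
    using E by simp
  ultimately have "F * D * cadj F = A'" by simp
  then have "A = (U * F) * D * cadj (U * F)"
    by (subst A_eq) (auto simp: cadj_mult mult_assoc_dim D_def)
  moreover have "cadj (U * F) * (U * F) = 1\<^sub>m n"
  proof -
    have "cadj (U * F) * (U * F) = cadj F * ((cadj U * U) * F)"
      by (simp add: cadj_mult mult_assoc_dim)
    then show ?thesis using F by (simp add: U(2) FF)
  qed
  moreover have "U * F \<in> carrier_mat n n" using U F by auto
  ultimately show ?case unfolding D_def by blast
qed

subsection \<open>Positive semidefinite matrices\<close>

lemma cadj_smult: "cadj (c \<cdot>\<^sub>m A) = cnj c \<cdot>\<^sub>m cadj A"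
  by (rule eq_matI) auto

text \<open>Like \<open>mult_assoc_dim\<close>, this has dimension premises rather than carriers, so
  \<open>simp\<close> can discharge them and use the equation for rewriting.\<close>

lemma smult_mult_left: "dim_col A = dim_row B \<Longrightarrow> (c \<cdot>\<^sub>m A) * B = c \<cdot>\<^sub>m (A * (B :: complex mat))"
  by (rule mult_smult_assoc_mat[of A "dim_row A" "dim_row B" B "dim_col B"]) (rule carrier_matI; simp)+

lemma smult_mult_right: "dim_col A = dim_row B \<Longrightarrow> A * (c \<cdot>\<^sub>m B) = c \<cdot>\<^sub>m (A * (B :: complex mat))"
  by (rule mult_smult_distrib[of A "dim_row A" "dim_row B" B "dim_col B"]) (rule carrier_matI; simp)+

text \<open>The quadratic form at \<open>v\<close> is the squared norm of \<open>cadj V\<close>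
  applied to \<open>v\<close>, whose entries are called \<open>z k\<close> below.\<close>

lemma psd_gram:
  assumes V: "V \<in> carrier_mat n m"
  shows "psd_mat n (V * cadj V)"
  unfolding psd_mat_def
proof (intro conjI ballI)
  note dims [simp] = carrier_matD[OF V]
  show "V * cadj V \<in> carrier_mat n n" using V by auto
  show "cadj (V * cadj V) = V * cadj V" by (simp add: cadj_mult)
  fix v :: "complex vec" assume "v \<in> carrier_vec n"
  define z where "z k = (\<Sum>j<n. cnj (V $$ (j, k)) * v $ j)" for k
  have "(\<Sum>i<n. \<Sum>j<n. cnj (v $ i) * (V * cadj V) $$ (i, j) * v $ j)
    = (\<Sum>i<n. \<Sum>j<n. \<Sum>k<m. (cnj (v $ i) * V $$ (i, k)) * (cnj (V $$ (j, k)) * v $ j))"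
    by (intro sum.cong refl, subst mult_index_sum)
      (auto simp: sum_distrib_left sum_distrib_right algebra_simps)
  also have "\<dots> = (\<Sum>i<n. \<Sum>k<m. \<Sum>j<n. (cnj (v $ i) * V $$ (i, k)) * (cnj (V $$ (j, k)) * v $ j))"
    by (rule sum.cong[OF refl], rule sum.swap)
  also have "\<dots> = (\<Sum>k<m. \<Sum>i<n. \<Sum>j<n. (cnj (v $ i) * V $$ (i, k)) * (cnj (V $$ (j, k)) * v $ j))"
    by (rule sum.swap)
  also have "\<dots> = (\<Sum>k<m. cnj (z k) * z k)"
    unfolding z_def cnj_sum sum_product by (intro sum.cong refl) simp
  also have "\<dots> = (\<Sum>k<m. complex_of_real ((cmod (z k))\<^sup>2))"
    by (simp add: complex_norm_square mult.commute del: of_real_power)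
  finally show "0 \<le> Re (\<Sum>i<n. \<Sum>j<n. cnj (v $ i) * (V * cadj V) $$ (i, j) * v $ j)"
    by (simp add: sum_nonneg del: of_real_power)
qed

lemma psd_matD: "psd_mat n A \<Longrightarrow> A \<in> carrier_mat n n" "psd_mat n A \<Longrightarrow> cadj A = A"
  unfolding psd_mat_def by blast+

text \<open>Each \<open>f k\<close> is the quadratic form of \<open>A\<close> at column
  \<open>k\<close> of \<open>U\<close>. The diagonal is complex here because it comes from roots of
  a complex characteristic polynomial.\<close>

lemma psd_eigenvalues:
  assumes psd: "psd_mat n A" and U: "U \<in> carrier_mat n n" "cadj U * U = 1\<^sub>m n"
    and A_eq: "A = U * mat_diag n f * cadj U" and k: "k < n"
  shows "0 \<le> Re (f k)" "f k = complex_of_real (Re (f k))"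
proof -
  note dims [simp] = carrier_matD[OF U(1)] carrier_matD[OF psd_matD(1)[OF psd]]
  have D: "cadj U * (A * U) = mat_diag n f"
  proof -
    have "cadj U * (A * U) = (cadj U * U) * mat_diag n f * (cadj U * U)"
      by (simp add: A_eq mult_assoc_dim)
    then show ?thesis by (simp add: U(2))
  qed
  have "f k = (cadj U * (A * U)) $$ (k, k)" using k by (simp add: D mat_diag_def)
  also have "\<dots> = (\<Sum>i<n. cnj (U $$ (i, k)) * (\<Sum>j<n. A $$ (i, j) * U $$ (j, k)))"
    using k by (subst mult_index_sum, simp, simp, simp, intro sum.cong)
      (auto simp: mult_index_sum simp del: index_mult_mat(1))
  also have "\<dots> = (\<Sum>i<n. \<Sum>j<n. cnj (col U k $ i) * A $$ (i, j) * col U k $ j)"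
    using k by (simp add: sum_distrib_left mult.assoc)
  finally have fk: "f k = (\<Sum>i<n. \<Sum>j<n. cnj (col U k $ i) * A $$ (i, j) * col U k $ j)" .
  have "col U k \<in> carrier_vec n" by (rule col_carrier_vec[OF k U(1)])
  then show "0 \<le> Re (f k)"
    unfolding fk by (rule bspec[OF psd[unfolded psd_mat_def, THEN conjunct2, THEN conjunct2]])
  have "cadj (cadj U * (A * U)) = cadj U * (A * U)"
    using psd_matD(2)[OF psd] by (simp add: cadj_mult mult_assoc_dim)
  then have "cadj (mat_diag n f) = mat_diag n f" by (simp only: D)
  from arg_cong[OF this, of "\<lambda>M. M $$ (k, k)"] have "cnj (f k) = f k"
    using k by (simp add: mat_diag_def)
  then show "f k = complex_of_real (Re (f k))"
    by (simp add: complex_eq_iff)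
qed

lemma psd_spectral:
  assumes "psd_mat n A"
  shows "\<exists>U d. U \<in> carrier_mat n n \<and> cadj U * U = 1\<^sub>m n \<and> (\<forall>i<n. 0 \<le> d i) \<and>
    A = U * mat_diag n (\<lambda>i. complex_of_real (d i)) * cadj U"
proof -
  obtain es where es: "char_poly A = (\<Prod>a\<leftarrow>es. [:- a, 1:])"
    using char_poly_factorized[OF psd_matD(1)[OF assms]] by blast
  obtain U where U: "U \<in> carrier_mat n n" "cadj U * U = 1\<^sub>m n"
    and A_eq: "A = U * mat_diag n (\<lambda>i. es ! i) * cadj U"
    using hermitian_spectral[OF psd_matD[OF assms] es] by blast
  note ev = psd_eigenvalues[OF assms U A_eq]
  have "mat_diag n (\<lambda>i. es ! i) = mat_diag n (\<lambda>i. complex_of_real (Re (es ! i)))"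
    by (rule eq_matI) (use ev(2) in \<open>auto simp: mat_diag_def\<close>)
  then show ?thesis
    using U A_eq ev(1) by (intro exI[of _ U] exI[of _ "\<lambda>i. Re (es ! i)"]) simp
qed

text \<open>Converse of \<open>psd_gram\<close>, with the square roots of the eigenvalues.
  Congruence, scaling and Kronecker products act on the factor \<open>V\<close> directly, which is
  how their positivity is proved.\<close>

lemma psd_decomp:
  assumes "psd_mat n A"
  shows "\<exists>V \<in> carrier_mat n n. A = V * cadj V"
proof -
  obtain U d where U: "U \<in> carrier_mat n n" "cadj U * U = 1\<^sub>m n"
    and d: "\<forall>i<n. 0 \<le> d i" and A_eq: "A = U * mat_diag n (\<lambda>i. complex_of_real (d i)) * cadj U"
    using psd_spectral[OF assms] by blast
  define S where "S = mat_diag n (\<lambda>i. complex_of_real (sqrt (d i)))"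
  have S: "S \<in> carrier_mat n n" "cadj S = S" by (auto simp: S_def cadj_mat_diag)
  have "mat_diag n (\<lambda>i. complex_of_real (d i)) = S * S"
    unfolding S_def mat_diag_diag
    by (rule eq_matI) (use d in \<open>auto simp: mat_diag_def simp flip: of_real_mult\<close>)
  then have "A = (U * S) * cadj (U * S)"
    using U S by (simp add: A_eq cadj_mult mult_assoc_dim)
  with U S show ?thesis by (intro bexI[of _ "U * S"]) auto
qed

lemma psd_congr:
  assumes "psd_mat n S" "B \<in> carrier_mat m n"
  shows "psd_mat m (B * S * cadj B)"
proof -
  obtain V where V: "V \<in> carrier_mat n n" "S = V * cadj V"
    using psd_decomp[OF assms(1)] by blast
  have "B * S * cadj B = (B * V) * cadj (B * V)"
    using V assms(2) by (simp add: cadj_mult mult_assoc_dim)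
  then show ?thesis
    using psd_gram[of "B * V" m n] V assms(2) by auto
qed

lemma psd_add:
  assumes "psd_mat n A" "psd_mat n B"
  shows "psd_mat n (A + B)"
proof -
  note A = psd_matD[OF assms(1)] and B = psd_matD[OF assms(2)]
  have "cadj (A + B) = A + B"
    using A B by (simp add: cadj_add)
  moreover have "0 \<le> Re (\<Sum>i<n. \<Sum>j<n. cnj (v $ i) * (A + B) $$ (i, j) * v $ j)"
    if v: "v \<in> carrier_vec n" for v
  proof -
    have "(\<Sum>i<n. \<Sum>j<n. cnj (v $ i) * (A + B) $$ (i, j) * v $ j)
      = (\<Sum>i<n. \<Sum>j<n. cnj (v $ i) * A $$ (i, j) * v $ j) + (\<Sum>i<n. \<Sum>j<n. cnj (v $ i) * B $$ (i, j) * v $ j)"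
      using A(1) B(1) by (simp add: distrib_left distrib_right sum.distrib)
    moreover have "0 \<le> Re (\<Sum>i<n. \<Sum>j<n. cnj (v $ i) * A $$ (i, j) * v $ j)"
      using assms(1)[unfolded psd_mat_def, THEN conjunct2, THEN conjunct2] v by (rule bspec)
    moreover have "0 \<le> Re (\<Sum>i<n. \<Sum>j<n. cnj (v $ i) * B $$ (i, j) * v $ j)"
      using assms(2)[unfolded psd_mat_def, THEN conjunct2, THEN conjunct2] v by (rule bspec)
    ultimately show ?thesis by (simp only: plus_complex.sel)
  qed
  ultimately show ?thesis
    unfolding psd_mat_def using add_carrier_mat[OF B(1), of A] by blast
qed

lemma psd_smult:
  assumes "psd_mat n A" "0 \<le> c"
  shows "psd_mat n (complex_of_real c \<cdot>\<^sub>m A)"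
proof -
  obtain V where V: "V \<in> carrier_mat n n" "A = V * cadj V"
    using psd_decomp[OF assms(1)] by blast
  have "complex_of_real c \<cdot>\<^sub>m A
    = (complex_of_real (sqrt c) \<cdot>\<^sub>m V) * cadj (complex_of_real (sqrt c) \<cdot>\<^sub>m V)"
    using V assms(2)
    by (intro eq_matI) (auto simp: cadj_smult smult_mult_left smult_mult_right simp flip: mult.assoc of_real_mult)
  then show ?thesis
    using psd_gram[of "complex_of_real (sqrt c) \<cdot>\<^sub>m V" n n] V by auto
qed

lemma psd_one: "psd_mat n (1\<^sub>m n)"
  using psd_gram[of "1\<^sub>m n" n n] by simp

lemma psd_kron:
  assumes "psd_mat a A" "psd_mat b B"
  shows "psd_mat (a * b) (kron A B)"
proof -
  obtain V W where V: "V \<in> carrier_mat a a" "A = V * cadj V" and W: "W \<in> carrier_mat b b" "B = W * cadj W"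
    using psd_decomp[OF assms(1)] psd_decomp[OF assms(2)] by blast
  have "kron A B = kron V W * cadj (kron V W)"
    using V W by (simp add: cadj_kron kron_mult)
  then show ?thesis
    using psd_gram[OF kron_carrier[OF V(1) W(1)]] by simp
qed

section \<open>Trace and determinant inequalities for positive semidefinite matrices\<close>

lemma psd_mtrace_nonneg:
  assumes "psd_mat n A"
  shows "0 \<le> Re (mtrace A)"
proof -
  obtain V where V: "V \<in> carrier_mat n n" "A = V * cadj V"
    using psd_decomp[OF assms] by blast
  have "Re (mtrace A) = (\<Sum>i<n. \<Sum>k<n. (cmod (V $$ (i, k)))\<^sup>2)"
    using V by (simp add: mtrace_def mult_index_sum del: index_mult_mat(1) of_real_power flip: complex_norm_square)
  then show ?thesis by (simp add: sum_nonneg)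
qed

text \<open>\<open>A * B\<close> need not be Hermitian, but by cyclicity its trace is that of the
  congruence \<open>cadj V * B * V\<close>.\<close>

lemma psd_mtrace_mult_nonneg:
  assumes "psd_mat n A" "psd_mat n B"
  shows "0 \<le> Re (mtrace (A * B))"
proof -
  obtain V where V: "V \<in> carrier_mat n n" "A = V * cadj V"
    using psd_decomp[OF assms(1)] by blast
  note B = psd_matD(1)[OF assms(2)]
  have "mtrace (A * B) = mtrace (V * (cadj V * B))"
    using V B by (simp add: mult_assoc_dim)
  also have "\<dots> = mtrace (cadj V * B * V)"
    using V B by (intro mtrace_mult_commute[of _ n n]) auto
  also have "0 \<le> Re \<dots>"
    using psd_mtrace_nonneg[OF psd_congr[OF assms(2) cadj_carrier[OF V(1)]]] by simp
  finally show ?thesis .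
qed

lemma psd_det:
  assumes "psd_mat n A"
  shows "0 \<le> Re (det A)" "Im (det A) = 0"
proof -
  obtain V where V: "V \<in> carrier_mat n n" "A = V * cadj V"
    using psd_decomp[OF assms] by blast
  have "det A = complex_of_real ((cmod (det V))\<^sup>2)"
    using V by (simp add: det_mult[OF V(1) cadj_carrier[OF V(1)]] det_cadj[OF V(1)] complex_norm_square del: of_real_power)
  then show "0 \<le> Re (det A)" "Im (det A) = 0" by (simp_all del: of_real_power)
qed

lemma det_right_inverse_nonzero:
  fixes A B :: "complex mat"
  assumes "A \<in> carrier_mat n n" "B \<in> carrier_mat n n" "A * B = 1\<^sub>m n"
  shows "det A \<noteq> 0"
proof
  assume "det A = 0"
  with det_mult[OF assms(1,2)] show False by (simp add: assms(3))
qed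

lemma psd_det_pos:
  assumes "psd_mat n A" "B \<in> carrier_mat n n" "A * B = 1\<^sub>m n"
  shows "0 < Re (det A)"
proof -
  have "det A \<noteq> 0"
    using det_right_inverse_nonzero[OF psd_matD(1)[OF assms(1)] assms(2,3)] .
  then have "Re (det A) \<noteq> 0"
    using psd_det(2)[OF assms(1)] by (simp add: complex_eq_iff)
  then show ?thesis using psd_det(1)[OF assms(1)] by simp
qed

text \<open>The inequality \<open>d \<le> exp (d - 1)\<close> for every eigenvalue; this is the
  tangent bound at the identity matrix.\<close>

lemma psd_det_le_exp_trace:
  assumes "psd_mat n A"
  shows "Re (det A) \<le> exp (Re (mtrace A) - real n)"
proof -
  obtain U d where U: "U \<in> carrier_mat n n" "cadj U * U = 1\<^sub>m n"
    and d: "\<forall>i<n. 0 \<le> d i" and A_eq: "A = U * mat_diag n (\<lambda>i. complex_of_real (d i)) * cadj U"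
    using psd_spectral[OF assms] by blast
  let ?D = "mat_diag n (\<lambda>i. complex_of_real (d i))"
  have "similar_mat_wit A ?D U (cadj U)"
    by (rule similar_mat_witI[OF unitary_right_inverse[OF U] U(2) A_eq psd_matD(1)[OF assms] _ U(1)
          cadj_carrier[OF U(1)]]) simp
  then have "det A = det ?D"
    by (intro det_similar) (auto simp: similar_mat_def)
  then have "Re (det A) = (\<Prod>i<n. d i)"
    by (simp add: det_mat_diag flip: of_real_prod)
  also have "\<dots> \<le> (\<Prod>i<n. exp (d i - 1))"
  proof (rule prod_mono)
    fix i assume "i \<in> {..<n}"
    then show "0 \<le> d i \<and> d i \<le> exp (d i - 1)"
      using d exp_ge_add_one_self[of "d i - 1"] by auto
  qed
  also have "\<dots> = exp ((\<Sum>i<n. d i) - real n)"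
    by (simp add: sum_subtractf flip: exp_sum)
  also have "mtrace A = mtrace (U * (?D * cadj U))"
    using U by (simp add: A_eq mult_assoc_dim)
  then have "mtrace A = mtrace (?D * cadj U * U)"
    using U by (subst mtrace_mult_commute[of U n n, symmetric]) auto
  then have "(\<Sum>i<n. d i) = Re (mtrace A)"
    using U by (simp add: mult_assoc_dim mtrace_mat_diag)
  finally show ?thesis .
qed

text \<open>Concavity of \<^term>\<open>\<lambda>M. ln (det M)\<close>: its graph lies below the tangent plane at \<open>Q\<close>.\<close>

lemma psd_det_tangent_bound:
  assumes M: "psd_mat n M" and Q: "psd_mat n Q" and R: "R \<in> carrier_mat n n" "Q * R = 1\<^sub>m n"
  shows "Re (det M) \<le> Re (det Q) * exp (Re (mtrace (R * M)) - real n)"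
proof -
  obtain W where W: "W \<in> carrier_mat n n" "Q = W * cadj W"
    using psd_decomp[OF Q] by blast
  note dims [simp] = carrier_matD[OF W(1)] carrier_matD[OF R(1)] carrier_matD[OF psd_matD(1)[OF M]]
  \<comment> \<open>\<open>X\<close> is the inverse of \<open>W\<close>, since
    \<open>W * cadj W * R\<close> is the identity. Congruence by \<open>X\<close> takes
    \<open>Q\<close> to the identity and \<open>M\<close> to \<open>B\<close>, which reduces the
    claim to \<open>psd_det_le_exp_trace\<close>.\<close>
  define X where "X = cadj W * R"
  have X: "X \<in> carrier_mat n n" by (rule carrier_matI) (simp_all add: X_def)
  have WX: "W * X = 1\<^sub>m n"
    using R(2) by (simp add: X_def W(2) mult_assoc_dim)
  note dimsX [simp] = carrier_matD[OF X]
  have "cadj X * cadj W = 1\<^sub>m n"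
    by (simp add: WX flip: cadj_mult)
  moreover have "cadj X * X = cadj X * cadj W * R"
    by (simp add: X_def mult_assoc_dim)
  ultimately have R_eq: "R = cadj X * X"
    using R(1) by simp
  define B where "B = X * M * cadj X"
  have B: "psd_mat n B" unfolding B_def by (rule psd_congr[OF M X])
  note dimsB [simp] = carrier_matD[OF psd_matD(1)[OF B]]
  have "M = (W * X) * M * (cadj (W * X))"
    using psd_matD(1)[OF M] by (simp add: WX)
  then have "M = W * B * cadj W"
    by (simp add: B_def cadj_mult mult_assoc_dim)
  then have "det M = det W * det B * det (cadj W)"
    using W(1) psd_matD(1)[OF B] cadj_carrier[OF W(1)]
    by (simp add: det_mult[of _ n])
  also have "\<dots> = det Q * det B"
    using W(1) cadj_carrier[OF W(1)] by (simp add: W(2) det_mult[of _ n])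
  finally have "Re (det M) = Re (det Q) * Re (det B)"
    by (simp add: psd_det(2)[OF Q] psd_det(2)[OF B])
  moreover have "mtrace B = mtrace (R * M)"
    using mtrace_mult_commute[of "X * M" n n "cadj X"] X psd_matD(1)[OF M] cadj_carrier[OF X]
    by (simp add: B_def R_eq mult_assoc_dim)
  ultimately show ?thesis
    using psd_det_le_exp_trace[OF B] psd_det(1)[OF Q] by (simp add: mult_left_mono)
qed

subsection \<open>The raised cosine Toeplitz matrix\<close>

text \<open>The cut-off by \<open>max 0\<close> merges the flat part, where the cosine is 1, with
  the roll-off into a single formula that is visibly continuous. For \<open>\<beta> = 0\<close>
  division by zero gives 0, the cosine is again 1 and the formula still holds.\<close>

lemma rc_spectrum_eq:
  assumes "0 \<le> \<beta>" "T > 0" "\<bar>f\<bar> \<le> (1 + \<beta>) / (2 * T)"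
  shows "rc_spectrum \<beta> T f = T / 2 * (1 + cos (pi * T / \<beta> * max 0 (\<bar>f\<bar> - (1 - \<beta>) / (2 * T))))"
proof (cases "\<bar>f\<bar> \<le> (1 - \<beta>) / (2 * T)")
  case True
  then have "max 0 (\<bar>f\<bar> - (1 - \<beta>) / (2 * T)) = 0" by simp
  with True show ?thesis by (simp add: rc_spectrum_def)
next
  case False
  then have "max 0 (\<bar>f\<bar> - (1 - \<beta>) / (2 * T)) = \<bar>f\<bar> - (1 - \<beta>) / (2 * T)" by simp
  with False assms(3) show ?thesis by (simp add: rc_spectrum_def)
qed

lemma rc_spectrum_outside:
  assumes "0 \<le> \<beta>" "T > 0" "(1 + \<beta>) / (2 * T) < \<bar>f\<bar>"
  shows "rc_spectrum \<beta> T f = 0"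
proof -
  have "(1 - \<beta>) / (2 * T) \<le> (1 + \<beta>) / (2 * T)"
    using assms by (intro divide_right_mono) auto
  with assms show ?thesis by (simp add: rc_spectrum_def)
qed

lemma rc_spectrum_pos:
  assumes "0 \<le> \<beta>" "T > 0" "\<bar>f\<bar> < (1 + \<beta>) / (2 * T)"
  shows "0 < rc_spectrum \<beta> T f"
proof (cases "\<bar>f\<bar> \<le> (1 - \<beta>) / (2 * T)")
  case False
  define x where "x = pi * T / \<beta> * (\<bar>f\<bar> - (1 - \<beta>) / (2 * T))"
  \<comment> \<open>For \<open>\<beta> = 0\<close> the flat part fills the whole band, contrary to
    the case assumption.\<close>
  have "\<beta> \<noteq> 0" using False assms(3) by auto
  then have "\<beta> > 0" using assms(1) by simp
  have "\<bar>f\<bar> - (1 - \<beta>) / (2 * T) < (1 + \<beta>) / (2 * T) - (1 - \<beta>) / (2 * T)"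
    using assms(3) by simp
  also have "\<dots> = \<beta> / T" using assms(2) by (simp add: field_simps)
  finally have "x < pi * T / \<beta> * (\<beta> / T)"
    unfolding x_def using \<open>\<beta> > 0\<close> assms(2) by (intro mult_strict_left_mono) auto
  also have "\<dots> = pi" using \<open>\<beta> > 0\<close> assms(2) by simp
  finally have "x < pi" .
  moreover have "0 \<le> x"
    unfolding x_def using False \<open>\<beta> > 0\<close> assms(2) by (intro mult_nonneg_nonneg) auto
  ultimately have "cos pi < cos x" by (intro cos_monotone_0_pi) auto
  then have "0 < T / 2 * (1 + cos x)" using assms(2) by simp
  then show ?thesis
    using False assms(3) by (simp add: rc_spectrum_def x_def)
qed (use assms in \<open>simp add: rc_spectrum_def\<close>)

text \<open>Restricted to the closed band because for \<open>\<beta> = 0\<close> the spectrum jumps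
  to 0 just outside it.\<close>

lemma rc_spectrum_continuous_on:
  assumes "0 \<le> \<beta>" "T > 0"
  shows "continuous_on {- ((1 + \<beta>) / (2 * T))..(1 + \<beta>) / (2 * T)} (rc_spectrum \<beta> T)"
proof -
  have "continuous_on {- ((1 + \<beta>) / (2 * T))..(1 + \<beta>) / (2 * T)}
    (\<lambda>f. T / 2 * (1 + cos (pi * T / \<beta> * max 0 (\<bar>f\<bar> - (1 - \<beta>) / (2 * T)))))"
    unfolding divide_inverse by (intro continuous_intros)
  then show ?thesis
    by (rule continuous_on_eq) (use assms in \<open>auto simp: rc_spectrum_eq abs_le_iff\<close>)
qed

text \<open>The operator \<open>integral\<close> in the definition of the pulse has a default value;
  compact support and continuity show that here it is a genuine integral, over the band.\<close>

lemma rc_pulse_has_integral: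
  assumes "0 \<le> \<beta>" "T > 0"
  shows "((\<lambda>f. complex_of_real (rc_spectrum \<beta> T f) * cis (2 * pi * f * t)) has_integral rc_pulse \<beta> T t)
    {- ((1 + \<beta>) / (2 * T))..(1 + \<beta>) / (2 * T)}"
proof -
  let ?I = "{- ((1 + \<beta>) / (2 * T))..(1 + \<beta>) / (2 * T)}"
  let ?g = "\<lambda>f. complex_of_real (rc_spectrum \<beta> T f) * cis (2 * pi * f * t)"
  have int: "?g integrable_on ?I"
    by (intro integrable_continuous_real continuous_intros rc_spectrum_continuous_on[OF assms])
  have "integral ?I ?g = integral UNIV (\<lambda>f. if f \<in> ?I then ?g f else 0)"
    by (rule Henstock_Kurzweil_Integration.integral_restrict_UNIV[symmetric])
  also have "(\<lambda>f. if f \<in> ?I then ?g f else 0)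
    = (\<lambda>f. complex_of_real (rc_spectrum \<beta> T f) * exp (\<i> * complex_of_real (2 * pi * f * t)))"
  proof
    fix f
    show "(if f \<in> ?I then ?g f else 0)
      = complex_of_real (rc_spectrum \<beta> T f) * exp (\<i> * complex_of_real (2 * pi * f * t))"
      using rc_spectrum_outside[OF assms, of f] by (auto simp: cis_conv_exp abs_le_iff not_le)
  qed
  finally show ?thesis
    using integrable_integral[OF int] by (simp only: rc_pulse_def)
qed

text \<open>The spectrum is real, so conjugation only reverses the phase. This makes the Toeplitz
  matrix Hermitian.\<close>

lemma rc_pulse_minus:
  assumes "0 \<le> \<beta>" "T > 0"
  shows "rc_pulse \<beta> T (- t) = cnj (rc_pulse \<beta> T t)"
proof -
  have "((\<lambda>f. cnj (complex_of_real (rc_spectrum \<beta> T f) * cis (2 * pi * f * t))) has_integral cnj (rc_pulse \<beta> T t))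
    {- ((1 + \<beta>) / (2 * T))..(1 + \<beta>) / (2 * T)}"
    using has_integral_cnj[THEN iffD2, OF rc_pulse_has_integral[OF assms]] by (simp only: o_def)
  moreover have "cnj (complex_of_real (rc_spectrum \<beta> T f) * cis (2 * pi * f * t))
    = complex_of_real (rc_spectrum \<beta> T f) * cis (2 * pi * f * - t)" for f
    by (simp add: cis_cnj)
  ultimately show ?thesis
    using has_integral_unique[OF rc_pulse_has_integral[OF assms, of "- t"]] by (simp only:)
qed

section \<open>Positive definiteness of the Toeplitz matrix\<close>

lemma toeplitz_G_carrier [simp]: "toeplitz_G \<beta> T \<delta> N \<in> carrier_mat N N"
  by (simp add: toeplitz_G_def)

text \<open>The phase is written as a power, so that this is the polynomial with coefficients
  \<open>v\<close> evaluated at a point of the unit circle.\<close>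

definition fourier_sum :: "real \<Rightarrow> real \<Rightarrow> nat \<Rightarrow> complex vec \<Rightarrow> real \<Rightarrow> complex" where
  "fourier_sum T \<delta> N v f = (\<Sum>j<N. v $ j * cis (- (2 * pi * f * \<delta> * T)) ^ j)"

lemma fourier_energy_integrable:
  assumes "0 \<le> \<beta>" "T > 0"
  shows "(\<lambda>f. rc_spectrum \<beta> T f * (cmod (fourier_sum T \<delta> N v f))\<^sup>2) integrable_on
    {- ((1 + \<beta>) / (2 * T))..(1 + \<beta>) / (2 * T)}"
  unfolding fourier_sum_def
  by (intro integrable_continuous_real continuous_intros rc_spectrum_continuous_on[OF assms])

text \<open>Every entry is an integral of the spectrum against a phase in \<open>i - j\<close>. The
  phase splits as \<open>cnj (w ^ i) * w ^ j\<close>, so under the integral the double sum is a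
  product of conjugates.\<close>

lemma toeplitz_G_quadratic_form:
  assumes "0 \<le> \<beta>" "T > 0"
  shows "(\<Sum>i<N. \<Sum>j<N. cnj (v $ i) * toeplitz_G \<beta> T \<delta> N $$ (i, j) * v $ j)
    = complex_of_real (integral {- ((1 + \<beta>) / (2 * T))..(1 + \<beta>) / (2 * T)}
        (\<lambda>f. rc_spectrum \<beta> T f * (cmod (fourier_sum T \<delta> N v f))\<^sup>2))"
proof -
  let ?I = "{- ((1 + \<beta>) / (2 * T))..(1 + \<beta>) / (2 * T)}"
  have 1: "((\<lambda>f. \<Sum>i<N. \<Sum>j<N. cnj (v $ i) *
        (complex_of_real (rc_spectrum \<beta> T f) * cis (2 * pi * f * ((real i - real j) * \<delta> * T))) * v $ j)
      has_integral (\<Sum>i<N. \<Sum>j<N. cnj (v $ i) * toeplitz_G \<beta> T \<delta> N $$ (i, j) * v $ j)) ?I"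
    by (intro has_integral_sum has_integral_mult_left has_integral_mult_right finite_lessThan)
      (simp add: toeplitz_G_def rc_pulse_has_integral[OF assms])
  have 2: "(\<Sum>i<N. \<Sum>j<N. cnj (v $ i) *
        (complex_of_real (rc_spectrum \<beta> T f) * cis (2 * pi * f * ((real i - real j) * \<delta> * T))) * v $ j)
      = complex_of_real (rc_spectrum \<beta> T f * (cmod (fourier_sum T \<delta> N v f))\<^sup>2)" for f
  proof -
    let ?w = "cis (- (2 * pi * f * \<delta> * T))"
    have w: "cis (2 * pi * f * ((real i - real j) * \<delta> * T)) = cnj (?w ^ i) * ?w ^ j" for i j :: nat
    proof -
      have "cnj (?w ^ i) * ?w ^ j = cis (- (real i * - (2 * pi * f * \<delta> * T)) + real j * - (2 * pi * f * \<delta> * T))"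
        by (simp only: Complex.DeMoivre cis_cnj cis_mult)
      also have "- (real i * - (2 * pi * f * \<delta> * T)) + real j * - (2 * pi * f * \<delta> * T)
          = 2 * pi * f * ((real i - real j) * \<delta> * T)"
        by (simp add: algebra_simps)
      finally show ?thesis by simp
    qed
    have "(\<Sum>i<N. \<Sum>j<N. cnj (v $ i) *
        (complex_of_real (rc_spectrum \<beta> T f) * cis (2 * pi * f * ((real i - real j) * \<delta> * T))) * v $ j)
      = complex_of_real (rc_spectrum \<beta> T f) *
        (\<Sum>i<N. \<Sum>j<N. (cnj (v $ i) * cnj (?w ^ i)) * (v $ j * ?w ^ j))"
      unfolding w sum_distrib_left by (intro sum.cong refl) (simp only: ac_simps)
    also have "(\<Sum>i<N. \<Sum>j<N. (cnj (v $ i) * cnj (?w ^ i)) * (v $ j * ?w ^ j))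
      = cnj (fourier_sum T \<delta> N v f) * fourier_sum T \<delta> N v f"
      by (simp add: fourier_sum_def sum_product)
    also have "\<dots> = complex_of_real ((cmod (fourier_sum T \<delta> N v f))\<^sup>2)"
      by (simp add: complex_norm_square mult.commute del: of_real_power)
    finally show ?thesis by (simp only: of_real_mult)
  qed
  have 3: "((\<lambda>f. complex_of_real (rc_spectrum \<beta> T f * (cmod (fourier_sum T \<delta> N v f))\<^sup>2)) has_integral
      complex_of_real (integral ?I (\<lambda>f. rc_spectrum \<beta> T f * (cmod (fourier_sum T \<delta> N v f))\<^sup>2))) ?I"
    by (intro has_integral_of_real integrable_integral fourier_energy_integrable[OF assms])
  show ?thesis
    using has_integral_unique[OF 1[unfolded 2] 3] .
qed

lemma rc_integrand_nonneg:
  assumes "0 \<le> \<beta>" "T > 0" "f \<in> {- ((1 + \<beta>) / (2 * T))..(1 + \<beta>) / (2 * T)}"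
  shows "0 \<le> rc_spectrum \<beta> T f"
proof -
  have f: "\<bar>f\<bar> \<le> (1 + \<beta>) / (2 * T)"
    using assms(3) by (simp add: abs_le_iff)
  show ?thesis
    unfolding rc_spectrum_eq[OF assms(1,2) f]
  proof (rule mult_nonneg_nonneg)
    show "0 \<le> 1 + cos x" for x :: real
      using cos_ge_minus_one[of x] by linarith
  qed (use assms in simp)
qed

lemma psd_toeplitz_G:
  assumes "0 \<le> \<beta>" "T > 0"
  shows "psd_mat N (toeplitz_G \<beta> T \<delta> N)"
  unfolding psd_mat_def
proof (intro conjI ballI)
  show "cadj (toeplitz_G \<beta> T \<delta> N) = toeplitz_G \<beta> T \<delta> N"
  proof (rule eq_matI)
    fix i j assume "i < dim_row (toeplitz_G \<beta> T \<delta> N)" "j < dim_col (toeplitz_G \<beta> T \<delta> N)"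
    moreover have "(real i - real j) * \<delta> * T = - ((real j - real i) * \<delta> * T)"
      by (simp add: algebra_simps)
    ultimately show "cadj (toeplitz_G \<beta> T \<delta> N) $$ (i, j) = toeplitz_G \<beta> T \<delta> N $$ (i, j)"
      by (simp add: toeplitz_G_def rc_pulse_minus[OF assms])
  qed (simp_all add: toeplitz_G_def)
  fix v :: "complex vec"
  show "0 \<le> Re (\<Sum>i<N. \<Sum>j<N. cnj (v $ i) * toeplitz_G \<beta> T \<delta> N $$ (i, j) * v $ j)"
    unfolding toeplitz_G_quadratic_form[OF assms] Re_complex_of_real
    by (intro integral_nonneg fourier_energy_integrable[OF assms] mult_nonneg_nonneg
        rc_integrand_nonneg[OF assms] zero_le_power2)
qed simp

text \<open>An interval of frequencies yields infinitely many points of the unit circle, and only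
  the zero polynomial has infinitely many roots.\<close>

lemma fourier_sum_zero_imp:
  fixes v :: "complex vec"
  assumes r: "0 < r" and T: "T > 0" and \<delta>: "\<delta> > 0"
    and zero: "\<And>f. 0 < f \<Longrightarrow> f < r \<Longrightarrow> fourier_sum T \<delta> N v f = 0"
    and k: "k < N"
  shows "v $ k = 0"
proof -
  define p where "p = (\<Sum>j<N. monom (v $ j) j)"
  \<comment> \<open>The second bound keeps the angle within \<open>[0, pi]\<close>, where the cosine
    is injective; hence distinct frequencies give distinct points.\<close>
  define s where "s = min r (1 / (2 * \<delta> * T))"
  have s: "0 < s" "s \<le> r" "2 * \<delta> * T * s \<le> 1"
    using r T \<delta> by (auto simp: s_def min_def field_simps)
  define h where "h f = cis (- (2 * pi * f * \<delta> * T))" for f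
  have inj: "inj_on h {0<..<s}"
  proof (rule inj_onI)
    fix x y assume xy: "x \<in> {0<..<s}" "y \<in> {0<..<s}" and "h x = h y"
    then have "cos (2 * pi * x * \<delta> * T) = cos (2 * pi * y * \<delta> * T)"
      by (metis h_def cis.sel(1) cos_minus)
    moreover have "0 \<le> 2 * pi * z * \<delta> * T \<and> 2 * pi * z * \<delta> * T \<le> pi" if "z \<in> {0<..<s}" for z
    proof -
      have "2 * \<delta> * T * z \<le> 2 * \<delta> * T * s" using that T \<delta> by (intro mult_left_mono) auto
      then have "2 * \<delta> * T * z \<le> 1" using s(3) by linarith
      then have "pi * (2 * \<delta> * T * z) \<le> pi * 1" by (intro mult_left_mono) auto
      then show ?thesis using that T \<delta> by (simp add: ac_simps)
    qed
    ultimately have "2 * pi * x * \<delta> * T = 2 * pi * y * \<delta> * T"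
      using xy cos_inj_pi by blast
    then show "x = y" using T \<delta> by simp
  qed
  have "infinite (h ` {0<..<s})"
    using infinite_Ioo[OF s(1)] finite_imageD[OF _ inj] by blast
  moreover have "h ` {0<..<s} \<subseteq> {x. poly p x = 0}"
    using zero s(2) by (auto simp: p_def h_def fourier_sum_def poly_sum poly_monom)
  ultimately have "p = 0"
    using poly_roots_finite[of p] finite_subset[of "h ` {0<..<s}"] by blast
  then have "coeff p k = 0" by simp
  then show ?thesis using k by (simp add: p_def coeff_sum)
qed

lemma toeplitz_G_right_inverse:
  assumes \<beta>: "0 \<le> \<beta>" and T: "T > 0" and \<delta>: "\<delta> > 0"
  shows "\<exists>B \<in> carrier_mat N N. toeplitz_G \<beta> T \<delta> N * B = 1\<^sub>m N"
proof -
  let ?G = "toeplitz_G \<beta> T \<delta> N"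
  let ?b = "(1 + \<beta>) / (2 * T)"
  have "det ?G \<noteq> 0"
  proof
    assume "det ?G = 0"
    then obtain v where v: "v \<in> carrier_vec N" "v \<noteq> 0\<^sub>v N" "?G *\<^sub>v v = 0\<^sub>v N"
      using det_0_iff_vec_prod_zero[OF toeplitz_G_carrier] by blast
    have "(\<Sum>i<N. \<Sum>j<N. cnj (v $ i) * ?G $$ (i, j) * v $ j) = (\<Sum>i<N. cnj (v $ i) * (?G *\<^sub>v v) $ i)"
      using v(1) carrier_matD[OF toeplitz_G_carrier[of \<beta> T \<delta> N]]
      by (intro sum.cong refl) (simp add: scalar_prod_def atLeast0LessThan sum_distrib_left mult.assoc)
    also have "\<dots> = 0" by (simp add: v(3))
    finally have "integral {- ?b..?b} (\<lambda>f. rc_spectrum \<beta> T f * (cmod (fourier_sum T \<delta> N v f))\<^sup>2) = 0"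
      unfolding toeplitz_G_quadratic_form[OF \<beta> T] by simp
    moreover have "continuous_on {- ?b..?b} (\<lambda>f. rc_spectrum \<beta> T f * (cmod (fourier_sum T \<delta> N v f))\<^sup>2)"
      unfolding fourier_sum_def by (intro continuous_intros rc_spectrum_continuous_on[OF \<beta> T])
    moreover have b: "0 < ?b" using \<beta> T by simp
    \<comment> \<open>A continuous nonnegative integrand with integral 0 vanishes at every point of
      the band, not merely almost everywhere.\<close>
    ultimately have 0: "rc_spectrum \<beta> T f * (cmod (fourier_sum T \<delta> N v f))\<^sup>2 = 0" if "f \<in> {- ?b..?b}" for f
      using integral_eq_0_iff[of "- ?b" ?b "\<lambda>f. rc_spectrum \<beta> T f * (cmod (fourier_sum T \<delta> N v f))\<^sup>2"] that
        rc_integrand_nonneg[OF \<beta> T] by auto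
    have "v $ k = 0" if "k < N" for k
    proof (rule fourier_sum_zero_imp[OF b T \<delta> _ that])
      fix f assume f: "0 < f" "f < ?b"
      then show "fourier_sum T \<delta> N v f = 0"
        using 0[of f] rc_spectrum_pos[OF \<beta> T, of f] by simp
    qed
    then have "v = 0\<^sub>v N" using v(1) by (intro eq_vecI) auto
    with v(2) show False by simp
  qed
  then have "?G * ((1 / det ?G) \<cdot>\<^sub>m adj_mat ?G) = 1\<^sub>m N"
    using adj_mat(1,2)[OF toeplitz_G_carrier[of \<beta> T \<delta> N]] carrier_matD[OF toeplitz_G_carrier[of \<beta> T \<delta> N]]
    by (intro eq_matI) (simp_all add: smult_mult_right)
  moreover have "(1 / det ?G) \<cdot>\<^sub>m adj_mat ?G \<in> carrier_mat N N"
    by (rule smult_carrier_mat[OF adj_mat(1)[OF toeplitz_G_carrier]])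
  ultimately show ?thesis by (rule bexI)
qed

subsection \<open>Functions of a Hermitian matrix\<close>

text \<open>Functional calculus: for unitary \<open>U\<close>, sums, products, trace and positivity
  of these matrices reduce to scalar statements about \<open>f i\<close>.\<close>

definition spectral_mat :: "complex mat \<Rightarrow> (nat \<Rightarrow> real) \<Rightarrow> complex mat" where
  "spectral_mat U f = U * mat_diag (dim_col U) (\<lambda>i. complex_of_real (f i)) * cadj U"

lemma spectral_mat_dim [simp]:
  "dim_row (spectral_mat U f) = dim_row U" "dim_col (spectral_mat U f) = dim_row U"
  by (simp_all add: spectral_mat_def)

lemma spectral_mat_carrier: "U \<in> carrier_mat n n \<Longrightarrow> spectral_mat U f \<in> carrier_mat n n"
  by (rule carrier_matI) simp_all

lemma spectral_mat_cong:
  "(\<And>i. i < dim_col U \<Longrightarrow> f i = g i) \<Longrightarrow> spectral_mat U f = spectral_mat U g"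
  unfolding spectral_mat_def
  by (rule arg_cong[of _ _ "\<lambda>D. U * D * cadj U"], rule eq_matI) (auto simp: mat_diag_def)

lemma spectral_mat_add: "spectral_mat U f + spectral_mat U g = spectral_mat U (\<lambda>i. f i + g i)"
proof -
  let ?n = "dim_col U"
  have U: "U \<in> carrier_mat (dim_row U) ?n" by (rule carrier_matI) simp_all
  have "mat_diag ?n (\<lambda>i. complex_of_real (f i)) + mat_diag ?n (\<lambda>i. complex_of_real (g i))
    = mat_diag ?n (\<lambda>i. complex_of_real (f i + g i))"
    by (rule eq_matI) (auto simp: mat_diag_def)
  then show ?thesis
    unfolding spectral_mat_def
    by (simp only: mult_add_distrib_mat[OF U mat_diag_dim mat_diag_dim, symmetric]
        add_mult_distrib_mat[OF mult_carrier_mat[OF U mat_diag_dim] mult_carrier_mat[OF U mat_diag_dim]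
          cadj_carrier[OF U], symmetric])
qed

lemma spectral_mat_smult: "complex_of_real c \<cdot>\<^sub>m spectral_mat U f = spectral_mat U (\<lambda>i. c * f i)"
proof -
  have "mat_diag (dim_col U) (\<lambda>i. complex_of_real (c * f i))
    = complex_of_real c \<cdot>\<^sub>m mat_diag (dim_col U) (\<lambda>i. complex_of_real (f i))"
    by (rule eq_matI) (auto simp: mat_diag_def)
  then show ?thesis
    by (simp add: spectral_mat_def smult_mult_left smult_mult_right)
qed

lemma spectral_mat_mult:
  assumes "cadj U * U = 1\<^sub>m (dim_col U)"
  shows "spectral_mat U f * spectral_mat U g = spectral_mat U (\<lambda>i. f i * g i)"
proof -
  let ?D = "\<lambda>f. mat_diag (dim_col U) (\<lambda>i. complex_of_real (f i))"
  have "spectral_mat U f * spectral_mat U g = U * (?D f * ((cadj U * U) * (?D g * cadj U)))"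
    by (simp add: spectral_mat_def mult_assoc_dim)
  also have "\<dots> = U * ((?D f * ?D g) * cadj U)"
    by (simp add: assms mult_assoc_dim del: mat_diag_diag)
  also have "?D f * ?D g = ?D (\<lambda>i. f i * g i)"
    by simp
  finally show ?thesis by (simp add: spectral_mat_def mult_assoc_dim)
qed

lemma spectral_mat_one:
  assumes "U \<in> carrier_mat n n" "cadj U * U = 1\<^sub>m n"
  shows "spectral_mat U (\<lambda>_. 1) = 1\<^sub>m n"
  using assms unitary_right_inverse[OF assms] by (simp add: spectral_mat_def)

lemma mtrace_spectral_mat:
  assumes "U \<in> carrier_mat n n" "cadj U * U = 1\<^sub>m n"
  shows "mtrace (spectral_mat U f) = complex_of_real (\<Sum>i<n. f i)"
proof -
  let ?D = "mat_diag n (\<lambda>i. complex_of_real (f i))"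
  have dims [simp]: "dim_row U = n" "dim_col U = n" using assms(1) by simp_all
  have "mtrace (spectral_mat U f) = mtrace (?D * cadj U * U)"
    unfolding spectral_mat_def
    by (subst mtrace_mult_commute[of "?D * cadj U" n n]) (auto simp: mult_assoc_dim)
  then show ?thesis by (simp add: mult_assoc_dim assms(2) mtrace_mat_diag)
qed

lemma psd_spectral_mat:
  assumes "U \<in> carrier_mat n n" "\<And>i. i < n \<Longrightarrow> 0 \<le> f i"
  shows "psd_mat n (spectral_mat U f)"
proof -
  let ?S = "mat_diag n (\<lambda>i. complex_of_real (sqrt (f i)))"
  have dims [simp]: "dim_row U = n" "dim_col U = n" using assms(1) by simp_all
  have "mat_diag n (\<lambda>i. complex_of_real (f i)) = ?S * ?S"
    unfolding mat_diag_diag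
    by (rule eq_matI) (use assms(2) in \<open>auto simp: mat_diag_def simp flip: of_real_mult\<close>)
  then have "spectral_mat U f = (U * ?S) * cadj (U * ?S)"
    by (simp add: spectral_mat_def cadj_mult cadj_mat_diag mult_assoc_dim del: mat_diag_diag)
  then show ?thesis
    using psd_gram[OF mult_carrier_mat[OF assms(1) mat_diag_dim]] by simp
qed

lemma det_kron_spectral_mat:
  assumes "U \<in> carrier_mat n n" "cadj U * U = 1\<^sub>m n"
  shows "det (kron (spectral_mat U f) (1\<^sub>m N)) = complex_of_real ((\<Prod>i<n. f i) ^ N)"
proof -
  let ?D = "mat_diag n (\<lambda>i. complex_of_real (f i))"
  let ?V = "kron U (1\<^sub>m N)" and ?E = "kron ?D (1\<^sub>m N)"
  have dims [simp]: "dim_row U = n" "dim_col U = n" using assms(1) by simp_all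
  have V: "?V \<in> carrier_mat (n * N) (n * N)" and E: "?E \<in> carrier_mat (n * N) (n * N)"
    by (rule carrier_matI; simp)+
  note cV = cadj_carrier[OF V]
  have eq: "kron (spectral_mat U f) (1\<^sub>m N) = ?V * ?E * cadj ?V"
    by (simp add: spectral_mat_def cadj_kron kron_mult)
  have "cadj ?V * ?V = 1\<^sub>m (n * N)"
    by (simp add: cadj_kron kron_mult assms(2) kron_one_one)
  then have "det (cadj ?V) * det ?V = 1"
    by (simp flip: det_mult[OF cV V])
  then have "det ?V * det ?E * det (cadj ?V) = det ?E"
    by (simp add: mult.commute mult.left_commute)
  then show ?thesis
    by (simp add: eq det_mult[OF mult_carrier_mat[OF V E] cV] det_mult[OF V E] det_kron_mat_diag_one)
qed

subsection \<open>The optimal input covariance\<close>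

text \<open>The optimiser \<open>S\<^sub>0\<close> is \<^term>\<open>kron (spectral_mat U \<alpha>) Gi\<close>; the two assumptions relating \<open>c\<close> and
  \<open>\<alpha>\<close> are the Karush--Kuhn--Tucker conditions of water-filling, with multiplier \<open>c\<close>.\<close>

locale waterfilling =
  fixes H G Gi U :: "complex mat" and K L N :: nat and \<tau> \<alpha> :: "nat \<Rightarrow> real" and s c :: real
  assumes H: "H \<in> carrier_mat K L" and U: "U \<in> carrier_mat L L" "cadj U * U = 1\<^sub>m L"
    and HH: "cadj H * H = spectral_mat U \<tau>"
    and G: "psd_mat N G" and Gi: "Gi \<in> carrier_mat N N" "G * Gi = 1\<^sub>m N"
    and s: "s > 0" and \<tau>_nonneg: "\<And>i. i < L \<Longrightarrow> 0 \<le> \<tau> i" and \<alpha>_nonneg: "\<And>i. i < L \<Longrightarrow> 0 \<le> \<alpha> i"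
    and kkt_le: "\<And>i. i < L \<Longrightarrow> \<tau> i / (s + \<alpha> i * \<tau> i) \<le> c"
    and kkt_eq: "\<And>i. i < L \<Longrightarrow> \<alpha> i * \<tau> i / (s + \<alpha> i * \<tau> i) = c * \<alpha> i"
begin

lemma dims [simp]:
  "dim_row H = K" "dim_col H = L" "dim_row U = L" "dim_col U = L"
  "dim_row G = N" "dim_col G = N" "dim_row Gi = N" "dim_col Gi = N"
  using H U(1) psd_matD(1)[OF G] Gi(1) by simp_all

abbreviation "F \<equiv> spectral_mat U"

lemma F_carrier: "F f \<in> carrier_mat L L"
  by (rule spectral_mat_carrier[OF U(1)])

lemma F_mult: "F f * F g = F (\<lambda>i. f i * g i)"
  by (rule spectral_mat_mult) (simp add: U(2))

lemma GiG: "Gi * G = 1\<^sub>m N"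
  using mat_mult_left_right_inverse[OF psd_matD(1)[OF G] Gi] .

lemma cadj_G: "cadj G = G"
  by (rule psd_matD(2)[OF G])

text \<open>\<open>cadj Gi\<close> is a left inverse of \<open>G\<close> and hence equal to
  \<open>Gi\<close>; then \<open>Gi = Gi * G * cadj Gi\<close> is a congruence of
  \<open>G\<close>.\<close>

lemma psd_Gi: "psd_mat N Gi"
proof -
  have "cadj Gi * G = 1\<^sub>m N"
    using arg_cong[OF Gi(2), of cadj] by (simp add: cadj_mult cadj_G)
  then have "cadj Gi * G * Gi = Gi" using Gi(1) by simp
  then have "cadj Gi = Gi"
    using cadj_carrier[OF Gi(1)] by (simp add: mult_assoc_dim Gi(2))
  moreover have "Gi * G * cadj Gi = cadj Gi"
    using cadj_carrier[OF Gi(1)] by (simp add: GiG)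
  ultimately show ?thesis
    using psd_congr[OF G Gi(1)] by simp
qed

definition noise :: "complex mat" where
  "noise = complex_of_real s \<cdot>\<^sub>m kron (1\<^sub>m K) G"

definition received :: "complex mat \<Rightarrow> complex mat" where
  "received S = kron H G * S * cadj (kron H G) + noise"

definition X :: "complex mat" where "X = H * F \<alpha> * cadj H"

text \<open>The solution of \<open>w i * (s + \<alpha> i * \<tau> i) = \<alpha> i\<close>, chosen so
  that \<open>Y\<close> becomes the inverse of \<open>X + s I\<close> times
  \<open>X\<close>.\<close>

definition w :: "nat \<Rightarrow> real" where "w i = \<alpha> i / (s + \<alpha> i * \<tau> i)"

definition Y :: "complex mat" where "Y = H * F w * cadj H"

definition S0 :: "complex mat" where "S0 = kron (F \<alpha>) Gi"

definition Ri :: "complex mat" where "Ri = complex_of_real (1 / s) \<cdot>\<^sub>m (1\<^sub>m K - Y)"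

lemma aux_dims [simp]:
  "dim_row noise = K * N" "dim_col noise = K * N"
  "dim_row X = K" "dim_col X = K" "dim_row Y = K" "dim_col Y = K"
  "dim_row S0 = L * N" "dim_col S0 = L * N" "dim_row Ri = K" "dim_col Ri = K"
  by (simp_all add: noise_def X_def Y_def S0_def Ri_def)

lemma denom_pos: "i < L \<Longrightarrow> 0 < s + \<alpha> i * \<tau> i"
  using s \<tau>_nonneg \<alpha>_nonneg by (simp add: add_pos_nonneg)

lemma psd_S0: "psd_mat (L * N) S0"
  unfolding S0_def by (intro psd_kron psd_spectral_mat[OF U(1)] \<alpha>_nonneg psd_Gi)

text \<open>\<open>Gi\<close> cancels the pulse correlation \<open>G\<close>, so each eigenmode
  power is counted \<open>N\<close> times.\<close>

lemma power_S0: "mtrace (kron (1\<^sub>m L) G * S0) = complex_of_real (real N * (\<Sum>i<L. \<alpha> i))"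
proof -
  have "kron (1\<^sub>m L) G * S0 = kron (F \<alpha>) (1\<^sub>m N)"
    using F_carrier[of \<alpha>] by (simp add: S0_def kron_mult Gi(2))
  then show ?thesis
    by (simp add: mtrace_kron[OF F_carrier one_carrier_mat] mtrace_spectral_mat[OF U] mtrace_one
        mult.commute del: of_real_sum)
qed

lemma psd_noise: "psd_mat (K * N) noise"
  unfolding noise_def using s by (intro psd_smult psd_kron psd_one G) simp

lemma psd_received: "psd_mat (L * N) S \<Longrightarrow> psd_mat (K * N) (received S)"
  unfolding received_def
  by (rule psd_add[OF psd_congr[OF _ kron_carrier[OF H psd_matD(1)[OF G]]] psd_noise])

lemma noise_det_pos: "0 < Re (det noise)"
proof (rule psd_det_pos[OF psd_noise])
  show "complex_of_real (1 / s) \<cdot>\<^sub>m kron (1\<^sub>m K) Gi \<in> carrier_mat (K * N) (K * N)"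
    by (rule carrier_matI) simp_all
  show "noise * (complex_of_real (1 / s) \<cdot>\<^sub>m kron (1\<^sub>m K) Gi) = 1\<^sub>m (K * N)"
    using s by (intro eq_matI)
      (simp_all add: noise_def smult_mult_left smult_mult_right kron_mult Gi(2) kron_one_one flip: mult.assoc of_real_mult)
qed

lemma received_S0: "received S0 = kron (X + complex_of_real s \<cdot>\<^sub>m 1\<^sub>m K) G"
proof -
  have "kron H G * S0 * cadj (kron H G) = kron X G"
    using psd_matD(1)[OF G] by (simp add: S0_def cadj_kron kron_mult cadj_G X_def Gi(2))
  then show ?thesis
    by (simp add: received_def noise_def kron_add_left kron_smult_left)
qed

lemma X_mult_Y: "X * Y = H * F (\<lambda>i. \<alpha> i * \<tau> i * w i) * cadj H"
proof -
  have "X * Y = H * (F \<alpha> * (cadj H * H) * F w * cadj H)"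
    by (simp add: X_def Y_def mult_assoc_dim)
  then show ?thesis by (simp add: HH F_mult mult_assoc_dim)
qed

text \<open>In other words \<open>X = (X + s I) * Y\<close>; subtracting from \<open>X + s I\<close>
  gives \<open>(X + s I) * (I - Y) = s I\<close>, the source of \<open>Ri\<close>.\<close>

lemma X_eq: "X = X * Y + complex_of_real s \<cdot>\<^sub>m Y"
proof -
  have "F \<alpha> = F (\<lambda>i. \<alpha> i * \<tau> i * w i + s * w i)"
  proof (rule spectral_mat_cong)
    fix i assume "i < dim_col U"
    then have "w i * (s + \<alpha> i * \<tau> i) = \<alpha> i"
      using denom_pos[of i] by (simp add: w_def)
    then show "\<alpha> i = \<alpha> i * \<tau> i * w i + s * w i"
      by (simp add: algebra_simps)
  qed
  also have "\<dots> = F (\<lambda>i. \<alpha> i * \<tau> i * w i) + complex_of_real s \<cdot>\<^sub>m F w"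
    by (simp add: spectral_mat_smult spectral_mat_add)
  finally have "X = H * (F (\<lambda>i. \<alpha> i * \<tau> i * w i) + complex_of_real s \<cdot>\<^sub>m F w) * cadj H"
    by (simp only: X_def)
  also have "\<dots> = X * Y + H * (complex_of_real s \<cdot>\<^sub>m F w) * cadj H"
    unfolding X_mult_Y
    by (simp only: mult_add_distrib_mat[OF H F_carrier smult_carrier_mat[OF F_carrier]]
        add_mult_distrib_mat[OF mult_carrier_mat[OF H F_carrier]
          mult_carrier_mat[OF H smult_carrier_mat[OF F_carrier]] cadj_carrier[OF H]])
  also have "H * (complex_of_real s \<cdot>\<^sub>m F w) * cadj H = complex_of_real s \<cdot>\<^sub>m Y"
    by (simp add: Y_def smult_mult_left smult_mult_right)
  finally show ?thesis .
qed

text \<open>\<open>Ri\<close> is the inverse given by the Woodbury identity.\<close>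

lemma X_plus_inverse: "(X + complex_of_real s \<cdot>\<^sub>m 1\<^sub>m K) * Ri = 1\<^sub>m K"
proof -
  have X: "X \<in> carrier_mat K K" and Y: "Y \<in> carrier_mat K K"
    by (rule carrier_matI; simp)+
  note sI = smult_carrier_mat[OF one_carrier_mat, of "complex_of_real s" K]
  have XY: "X $$ (i, j) = (X * Y) $$ (i, j) + complex_of_real s * Y $$ (i, j)" if "i < K" "j < K" for i j
    using arg_cong[OF X_eq, of "\<lambda>M. M $$ (i, j)"] that by simp
  have "(X + complex_of_real s \<cdot>\<^sub>m 1\<^sub>m K) * (1\<^sub>m K - Y)
    = (X * 1\<^sub>m K - X * Y) + (complex_of_real s \<cdot>\<^sub>m 1\<^sub>m K * 1\<^sub>m K - complex_of_real s \<cdot>\<^sub>m 1\<^sub>m K * Y)"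
    by (simp only: add_mult_distrib_mat[OF X sI minus_carrier_mat[OF Y]]
        mult_minus_distrib_mat[OF X one_carrier_mat Y] mult_minus_distrib_mat[OF sI one_carrier_mat Y])
  also have "\<dots> = (X - X * Y) + (complex_of_real s \<cdot>\<^sub>m 1\<^sub>m K - complex_of_real s \<cdot>\<^sub>m Y)"
    using X Y by (simp add: smult_mult_left)
  also have "\<dots> = complex_of_real s \<cdot>\<^sub>m 1\<^sub>m K"
    by (rule eq_matI) (simp_all add: XY del: index_mult_mat(1))
  finally show ?thesis
    using s by (intro eq_matI) (simp_all add: Ri_def smult_mult_right)
qed

lemma received_S0_inverse: "received S0 * kron Ri Gi = 1\<^sub>m (K * N)"
  by (simp add: received_S0 kron_mult X_plus_inverse Gi(2) kron_one_one)

text \<open>After the noise is factored out, \<open>I + X / s\<close> remains on the receive side,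
  while \<open>U\<close> diagonalises only on the transmit side; \<open>sylvester_det\<close>
  connects the two.\<close>

lemma received_S0_det:
  "Re (det (received S0)) = Re (det noise) * (\<Prod>i<L. 1 + \<alpha> i * \<tau> i / s) ^ N"
proof -
  let ?A = "kron H (1\<^sub>m N)" and ?B = "kron (complex_of_real (1 / s) \<cdot>\<^sub>m F \<alpha> * cadj H) (1\<^sub>m N)"
  let ?Z = "kron (1\<^sub>m K + complex_of_real (1 / s) \<cdot>\<^sub>m X) (1\<^sub>m N)"
  have A: "?A \<in> carrier_mat (K * N) (L * N)" and B: "?B \<in> carrier_mat (L * N) (K * N)"
    and Z: "?Z \<in> carrier_mat (K * N) (K * N)" and noise: "noise \<in> carrier_mat (K * N) (K * N)"
    by (rule carrier_matI; simp)+
  have "noise * ?Z = complex_of_real s \<cdot>\<^sub>m kron (1\<^sub>m K + complex_of_real (1 / s) \<cdot>\<^sub>m X) G"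
    using psd_matD(1)[OF G] by (simp add: noise_def smult_mult_left kron_mult)
  also have "\<dots> = kron (complex_of_real s \<cdot>\<^sub>m (1\<^sub>m K + complex_of_real (1 / s) \<cdot>\<^sub>m X)) G"
    by (simp only: kron_smult_left)
  also have "complex_of_real s \<cdot>\<^sub>m (1\<^sub>m K + complex_of_real (1 / s) \<cdot>\<^sub>m X) = X + complex_of_real s \<cdot>\<^sub>m 1\<^sub>m K"
    using s by (intro eq_matI) (simp_all add: distrib_left)
  finally have eq: "received S0 = noise * ?Z" by (simp only: received_S0)
  have "?Z = 1\<^sub>m (K * N) + ?A * ?B"
    by (simp add: kron_mult kron_add_left kron_one_one X_def smult_mult_left smult_mult_right mult_assoc_dim)
  then have "det ?Z = det (1\<^sub>m (L * N) + ?B * ?A)"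
    using sylvester_det[OF A B] by (simp only:)
  also have "1\<^sub>m (L * N) + ?B * ?A = kron (F (\<lambda>i. 1 + \<alpha> i * \<tau> i / s)) (1\<^sub>m N)"
  proof -
    have "complex_of_real (1 / s) \<cdot>\<^sub>m F \<alpha> * cadj H * H = F (\<lambda>i. 1 / s * (\<alpha> i * \<tau> i))"
      by (simp only: spectral_mat_smult) (simp add: mult_assoc_dim HH F_mult mult.assoc)
    then have "?B * ?A = kron (F (\<lambda>i. 1 / s * (\<alpha> i * \<tau> i))) (1\<^sub>m N)"
      by (simp add: kron_mult)
    moreover have "1\<^sub>m (L * N) = kron (F (\<lambda>_. 1)) (1\<^sub>m N)"
      by (simp add: spectral_mat_one[OF U] kron_one_one)
    ultimately show ?thesis
      by (simp add: spectral_mat_add flip: kron_add_left)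
  qed
  finally have det_Z: "det ?Z = complex_of_real ((\<Prod>i<L. 1 + \<alpha> i * \<tau> i / s) ^ N)"
    by (simp only: det_kron_spectral_mat[OF U])
  show ?thesis
    unfolding eq det_mult[OF noise Z] det_Z by (simp del: of_real_prod of_real_power)
qed

text \<open>Complementary slackness \<open>kkt_eq\<close> enters here: it turns
  \<open>w i * \<tau> i\<close> into \<open>c * \<alpha> i\<close>. The value fixes the noise
  contribution to the exponent.\<close>

lemma mtrace_Y: "mtrace Y = complex_of_real (c * (\<Sum>i<L. \<alpha> i))"
proof -
  have "mtrace Y = mtrace (H * (F w * cadj H))"
    by (simp add: Y_def mult_assoc_dim)
  also have "\<dots> = mtrace (F w * cadj H * H)"
    using H mult_carrier_mat[OF F_carrier cadj_carrier[OF H]] by (rule mtrace_mult_commute)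
  also have "\<dots> = complex_of_real (\<Sum>i<L. w i * \<tau> i)"
    by (simp add: mult_assoc_dim HH F_mult mtrace_spectral_mat[OF U] del: of_real_sum)
  also have "(\<Sum>i<L. w i * \<tau> i) = (\<Sum>i<L. c * \<alpha> i)"
    using kkt_eq by (intro sum.cong refl) (simp add: w_def)
  finally show ?thesis by (simp add: sum_distrib_left)
qed

text \<open>This is the gradient of the log-determinant in the input, up to the factor
  \<open>G\<close>. Its eigenvalues are the marginal gains that \<open>kkt_le\<close> bounds by
  \<open>c\<close>.\<close>

lemma sandwich: "cadj H * Ri * H = F (\<lambda>i. \<tau> i / (s + \<alpha> i * \<tau> i))"
proof -
  have Y: "Y \<in> carrier_mat K K" by (rule carrier_matI) simp_all
  have cHI: "cadj H * 1\<^sub>m K = cadj H" using cadj_carrier[OF H] by simp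
  have "cadj H * (1\<^sub>m K - Y) * H = cadj H * H - cadj H * Y * H"
    by (simp only: mult_minus_distrib_mat[OF cadj_carrier[OF H] one_carrier_mat Y] cHI
        minus_mult_distrib_mat[OF cadj_carrier[OF H] mult_carrier_mat[OF cadj_carrier[OF H] Y] H])
  also have "cadj H * Y * H = F (\<lambda>i. \<tau> i * w i * \<tau> i)"
  proof -
    have "cadj H * Y * H = (cadj H * H) * F w * (cadj H * H)"
      by (simp add: Y_def mult_assoc_dim)
    then show ?thesis by (simp add: HH F_mult)
  qed
  also have "cadj H * H - F (\<lambda>i. \<tau> i * w i * \<tau> i) = F (\<lambda>i. \<tau> i - \<tau> i * w i * \<tau> i)"
  proof -
    have "F \<tau> = F (\<lambda>i. \<tau> i - \<tau> i * w i * \<tau> i) + F (\<lambda>i. \<tau> i * w i * \<tau> i)"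
      by (simp add: spectral_mat_add)
    then show ?thesis
      unfolding HH by (intro eq_matI) simp_all
  qed
  finally have "cadj H * Ri * H = F (\<lambda>i. 1 / s * (\<tau> i - \<tau> i * w i * \<tau> i))"
    by (simp only: spectral_mat_smult[symmetric]) (simp add: Ri_def smult_mult_left smult_mult_right)
  also have "\<dots> = F (\<lambda>i. \<tau> i / (s + \<alpha> i * \<tau> i))"
  proof (rule spectral_mat_cong)
    fix i assume "i < dim_col U"
    then have "s + \<alpha> i * \<tau> i \<noteq> 0" using denom_pos[of i] by simp
    then show "1 / s * (\<tau> i - \<tau> i * w i * \<tau> i) = \<tau> i / (s + \<alpha> i * \<tau> i)"
      using s by (simp add: w_def divide_simps) (simp add: algebra_simps)
  qed
  finally show ?thesis .
qed

lemma mtrace_bound: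
  assumes S: "psd_mat (L * N) S"
  shows "Re (mtrace (kron Ri Gi * received S))
    \<le> c * Re (mtrace (kron (1\<^sub>m L) G * S)) + real N * (real K - c * (\<Sum>i<L. \<alpha> i))"
proof -
  let ?P = "kron H G" and ?R = "kron Ri Gi"
  let ?e = "\<lambda>i. \<tau> i / (s + \<alpha> i * \<tau> i)"
  note Sc = psd_matD(1)[OF S]
  have dS [simp]: "dim_row S = L * N" "dim_col S = L * N" using Sc by simp_all
  have P: "?P \<in> carrier_mat (K * N) (L * N)" and R: "?R \<in> carrier_mat (K * N) (K * N)"
    and noise: "noise \<in> carrier_mat (K * N) (K * N)"
    and IG: "kron (1\<^sub>m L) G \<in> carrier_mat (L * N) (L * N)"
    and EG: "kron (F ?e) G \<in> carrier_mat (L * N) (L * N)"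
    and DG: "kron (F (\<lambda>i. c - ?e i)) G \<in> carrier_mat (L * N) (L * N)"
    by (rule carrier_matI; simp)+
  have PSP: "?P * S * cadj ?P \<in> carrier_mat (K * N) (K * N)" by (rule carrier_matI) simp_all
  have "mtrace (?R * received S) = mtrace (?R * (?P * S * cadj ?P)) + mtrace (?R * noise)"
    unfolding received_def
    by (simp only: mult_add_distrib_mat[OF R PSP noise]
        mtrace_add[OF mult_carrier_mat[OF R PSP] mult_carrier_mat[OF R noise]])
  moreover have "mtrace (?R * noise) = complex_of_real (real N * (real K - c * (\<Sum>i<L. \<alpha> i)))"
  proof -
    have "?R * noise = kron (complex_of_real s \<cdot>\<^sub>m Ri) (1\<^sub>m N)"
      by (simp add: noise_def smult_mult_right kron_mult GiG kron_smult_left)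
    also have "complex_of_real s \<cdot>\<^sub>m Ri = 1\<^sub>m K - Y"
      using s by (intro eq_matI) (simp_all add: Ri_def)
    finally have "mtrace (?R * noise) = mtrace (1\<^sub>m K - Y) * complex_of_nat N"
      by (simp add: mtrace_kron[of _ K _ N] mtrace_one carrier_matI)
    also have "mtrace (1\<^sub>m K - Y) = complex_of_nat K - mtrace Y"
      by (simp add: mtrace_minus[of _ K] mtrace_one carrier_matI)
    finally show ?thesis by (simp add: mtrace_Y mult.commute del: of_real_sum)
  qed
  moreover have "mtrace (?R * (?P * S * cadj ?P)) = mtrace (kron (F ?e) G * S)"
  proof -
    have "mtrace (?R * (?P * S * cadj ?P)) = mtrace (?R * ?P * S * cadj ?P)"
      by (simp add: mult_assoc_dim)
    also have "\<dots> = mtrace (cadj ?P * (?R * ?P * S))"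
      by (rule mtrace_mult_commute[of _ "K * N" "L * N"]; rule carrier_matI; simp)
    also have "cadj ?P * (?R * ?P * S) = (cadj ?P * ?R * ?P) * S"
      by (simp add: mult_assoc_dim)
    also have "cadj ?P * ?R * ?P = kron (F ?e) G"
      using psd_matD(1)[OF G] by (simp add: cadj_kron kron_mult cadj_G Gi(2) sandwich)
    finally show ?thesis .
  qed
  moreover have "Re (mtrace (kron (F ?e) G * S)) \<le> c * Re (mtrace (kron (1\<^sub>m L) G * S))"
  proof -
    \<comment> \<open>\<open>kkt_le\<close> as a matrix inequality: \<open>c\<close> times the power
      functional minus the signal part is the trace of a product of two positive semidefinite
      matrices.\<close>
    have "psd_mat (L * N) (kron (F (\<lambda>i. c - ?e i)) G)"
      using kkt_le by (intro psd_kron psd_spectral_mat[OF U(1)] G) simp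
    then have nonneg: "0 \<le> Re (mtrace (kron (F (\<lambda>i. c - ?e i)) G * S))"
      by (rule psd_mtrace_mult_nonneg[OF _ S])
    have "kron (F ?e) G + kron (F (\<lambda>i. c - ?e i)) G = kron (F (\<lambda>i. c * 1)) G"
      by (simp add: spectral_mat_add flip: kron_add_left)
    also have "\<dots> = complex_of_real c \<cdot>\<^sub>m kron (1\<^sub>m L) G"
      by (simp only: spectral_mat_smult[symmetric] spectral_mat_one[OF U] kron_smult_left)
    finally have "mtrace ((kron (F ?e) G + kron (F (\<lambda>i. c - ?e i)) G) * S)
      = mtrace (complex_of_real c \<cdot>\<^sub>m kron (1\<^sub>m L) G * S)"
      by (simp only:)
    moreover have "mtrace ((kron (F ?e) G + kron (F (\<lambda>i. c - ?e i)) G) * S)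
      = mtrace (kron (F ?e) G * S) + mtrace (kron (F (\<lambda>i. c - ?e i)) G * S)"
      by (simp only: add_mult_distrib_mat[OF EG DG Sc]
          mtrace_add[OF mult_carrier_mat[OF EG Sc] mult_carrier_mat[OF DG Sc]])
    moreover have "mtrace (complex_of_real c \<cdot>\<^sub>m kron (1\<^sub>m L) G * S)
      = complex_of_real c * mtrace (kron (1\<^sub>m L) G * S)"
      by (simp add: smult_mult_left mtrace_smult[OF mult_carrier_mat[OF IG Sc]])
    ultimately have "mtrace (kron (F ?e) G * S) + mtrace (kron (F (\<lambda>i. c - ?e i)) G * S)
      = complex_of_real c * mtrace (kron (1\<^sub>m L) G * S)" by (simp only:)
    from arg_cong[OF this, of Re] nonneg show ?thesis by simp
  qed
  ultimately show ?thesis by simp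
qed

text \<open>When the power is at most that of \<open>S0\<close>, the terms with \<open>c\<close> in
  \<open>mtrace_bound\<close> sum to at most 0, leaving the trace at most \<open>K * N\<close>. The
  exponent of the tangent bound at \<open>S0\<close> is then nonpositive.\<close>

lemma received_det_le:
  assumes S: "psd_mat (L * N) S" and power: "Re (mtrace (kron (1\<^sub>m L) G * S)) \<le> real N * (\<Sum>i<L. \<alpha> i)"
    and c: "0 \<le> c"
  shows "Re (det (received S)) \<le> Re (det (received S0))"
proof -
  let ?x = "Re (mtrace (kron Ri Gi * received S)) - real (K * N)"
  have "c * Re (mtrace (kron (1\<^sub>m L) G * S)) \<le> c * (real N * (\<Sum>i<L. \<alpha> i))"
    by (rule mult_left_mono[OF power c])
  then have "?x \<le> 0"
    using mtrace_bound[OF S] by (simp add: algebra_simps)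
  have "kron Ri Gi \<in> carrier_mat (K * N) (K * N)"
    by (rule carrier_matI) simp_all
  from psd_det_tangent_bound[OF psd_received[OF S] psd_received[OF psd_S0] this received_S0_inverse]
  have "Re (det (received S)) \<le> Re (det (received S0)) * exp ?x" .
  also have "\<dots> \<le> Re (det (received S0)) * 1"
    using \<open>?x \<le> 0\<close> by (intro mult_left_mono psd_det(1)[OF psd_received[OF psd_S0]]) simp
  finally show ?thesis by simp
qed

end

section \<open>Water-filling and the capacity of a block\<close>

lemma water_level:
  fixes \<mu> s t :: real
  assumes \<mu>: "\<mu> > 0" and s: "s > 0" and t: "0 \<le> t"
  defines "a \<equiv> s * wf_pos \<mu> t"
  shows "0 \<le> a" "t / (s + a * t) \<le> \<mu> / s" "a * t / (s + a * t) = \<mu> / s * a"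
proof -
  have "0 \<le> wf_pos \<mu> t" by (simp add: wf_pos_def)
  then show a: "0 \<le> a" using s by (simp add: a_def)
  have "t / (s + a * t) \<le> \<mu> / s \<and> a * t / (s + a * t) = \<mu> / s * a"
  proof (cases "t > \<mu>")
    \<comment> \<open>An active mode: the power raises \<open>s + a * t\<close> exactly to
      \<open>s * t / \<mu>\<close>, which makes the marginal gain equal to the multiplier
      \<open>\<mu> / s\<close>.\<close>
    case True
    then have "1 / t < 1 / \<mu>" using \<mu> by (simp add: frac_less2)
    then have a_eq: "a = s * (1 / \<mu> - 1 / t)"
      using True \<mu> by (simp add: a_def wf_pos_def)
    have "s + a * t = s * t / \<mu>"
      using True \<mu> by (simp add: a_eq field_simps)
    then have "t / (s + a * t) = \<mu> / s"
      using True \<mu> s by simp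
    then show ?thesis by (metis order_refl mult.commute times_divide_eq_right)
  next
    case False
    have "a = 0"
    \<comment> \<open>With \<open>1 / 0 = 0\<close> the water-filling formula at
      \<open>t = 0\<close> would give \<open>1 / \<mu>\<close>; the separate branch of
      \<open>wf_pos\<close> gives 0.\<close>
    proof (cases "t = 0")
      case False
      then have "1 / \<mu> \<le> 1 / t" using \<open>\<not> t > \<mu>\<close> t by (intro divide_left_mono) auto
      then show ?thesis by (simp add: a_def wf_pos_def)
    qed (simp add: a_def wf_pos_def)
    then show ?thesis using False s by (simp add: divide_right_mono)
  qed
  then show "t / (s + a * t) \<le> \<mu> / s" "a * t / (s + a * t) = \<mu> / s * a" by blast+
qed

text \<open>The optimum does not depend on \<open>N\<close>, so no limit theorem for Toeplitz matrices is needed.\<close>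

lemma block_capacity_eq:
  fixes H :: "complex mat" and \<tau> :: "real list"
  assumes H: "H \<in> carrier_mat K L"
    and \<beta>: "0 \<le> \<beta>" and T: "T > 0" and \<delta>: "0 < \<delta>" and \<sigma>: "\<sigma>0\<^sup>2 > 0"
    and len: "length \<tau> = L"
    and cp: "char_poly (cadj H * H) = (\<Prod>a\<leftarrow>\<tau>. [:- complex_of_real a, 1:])"
    and \<mu>: "\<mu> > 0"
    and power: "\<sigma>0\<^sup>2 * (\<Sum>t\<leftarrow>\<tau>. wf_pos \<mu> t) = P * \<delta> * T"
    and N: "N \<ge> 1"
  shows "block_capacity H \<beta> T \<delta> \<sigma>0 P N = (\<Sum>t\<leftarrow>\<tau>. log 2 (1 + (\<sigma>0\<^sup>2 * wf_pos \<mu> t) * t / \<sigma>0\<^sup>2))"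
proof -
  define G where "G = toeplitz_G \<beta> T \<delta> N"
  have G: "psd_mat N G" unfolding G_def by (rule psd_toeplitz_G[OF \<beta> T])
  obtain Gi where Gi: "Gi \<in> carrier_mat N N" "G * Gi = 1\<^sub>m N"
    using toeplitz_G_right_inverse[OF \<beta> T \<delta>, of N] unfolding G_def by blast
  have psdHH: "psd_mat L (cadj H * H)"
    using psd_gram[OF cadj_carrier[OF H]] by simp
  have "char_poly (cadj H * H) = (\<Prod>a\<leftarrow>map complex_of_real \<tau>. [:- a, 1:])"
    by (simp add: cp o_def)
  then obtain U where U: "U \<in> carrier_mat L L" "cadj U * U = 1\<^sub>m L"
    and HH: "cadj H * H = U * mat_diag L (\<lambda>i. map complex_of_real \<tau> ! i) * cadj U"
    using hermitian_spectral[OF psd_matD[OF psdHH]] by blast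
  \<comment> \<open>The roots of the characteristic polynomial are real by hypothesis; their
    nonnegativity is derived from the Gram matrix.\<close>
  have \<tau>: "0 \<le> \<tau> ! i" if "i < L" for i
    using psd_eigenvalues(1)[OF psdHH U HH that] that len by simp
  have dU: "dim_col U = L" using U(1) by simp
  have "mat_diag L (\<lambda>i. map complex_of_real \<tau> ! i) = mat_diag L (\<lambda>i. complex_of_real (\<tau> ! i))"
    by (rule eq_matI) (auto simp: mat_diag_def len)
  then have HH': "cadj H * H = spectral_mat U (\<lambda>i. \<tau> ! i)"
    by (simp only: HH spectral_mat_def dU)
  define s where "s = \<sigma>0\<^sup>2"
  have s: "s > 0" using \<sigma> by (simp add: s_def)
  define \<alpha> where "\<alpha> i = s * wf_pos \<mu> (\<tau> ! i)" for i
  interpret waterfilling H G Gi U K L N "\<lambda>i. \<tau> ! i" \<alpha> s "\<mu> / s"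
  proof
    fix i assume i: "i < L"
    note wl = water_level[OF \<mu> s \<tau>[OF i], folded \<alpha>_def]
    show "0 \<le> \<tau> ! i" "0 \<le> \<alpha> i" "\<tau> ! i / (s + \<alpha> i * \<tau> ! i) \<le> \<mu> / s"
      "\<alpha> i * \<tau> ! i / (s + \<alpha> i * \<tau> ! i) = \<mu> / s * \<alpha> i"
      using \<tau>[OF i] wl by blast+
  qed (fact H U HH' G Gi s)+
  \<comment> \<open>The equation for \<open>\<mu>\<close> says that \<open>S0\<close> spends the
    whole power budget.\<close>
  have sum_\<alpha>: "(\<Sum>i<L. \<alpha> i) = P * \<delta> * T"
    using power by (simp add: \<alpha>_def s_def sum_list_sum_nth len atLeast0LessThan flip: sum_distrib_left)
  have Omega: "Sigma_Omega (dim_row H) \<beta> T \<delta> \<sigma>0 N = noise"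
    unfolding Sigma_Omega_def dims(1) s_def[symmetric] G_def[symmetric] by (rule noise_def[symmetric])
  have Y: "Sigma_Y H \<beta> T \<delta> \<sigma>0 N S = received S" for S
    unfolding Sigma_Y_def Omega G_def[symmetric] by (rule received_def[symmetric])
  have tx: "tx_power L \<beta> T \<delta> N S = Re (mtrace (kron (1\<^sub>m L) G * S)) / (real N * \<delta> * T)" for S
    unfolding tx_power_def G_def[symmetric] ..
  have scale: "0 < real N * \<delta> * T" using N \<delta> T by simp
  have tx_le: "tx_power L \<beta> T \<delta> N S \<le> P
      \<longleftrightarrow> Re (mtrace (kron (1\<^sub>m L) G * S)) \<le> real N * (\<Sum>i<L. \<alpha> i)" for S
    using pos_divide_le_eq[OF scale, of "Re (mtrace (kron (1\<^sub>m L) G * S))" P]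
    by (simp only: tx sum_\<alpha>) (simp only: ac_simps)
  let ?f = "\<lambda>S. 1 / real N * log 2 (Re (det (Sigma_Y H \<beta> T \<delta> \<sigma>0 N S))
                           / Re (det (Sigma_Omega (dim_row H) \<beta> T \<delta> \<sigma>0 N)))"
  let ?A = "{S. psd_mat (dim_col H * N) S \<and> tx_power (dim_col H) \<beta> T \<delta> N S \<le> P}"
  have Omega_pos: "0 < Re (det noise)" by (rule noise_det_pos)
  have prod_ge_1: "1 \<le> (\<Prod>i<L. 1 + \<alpha> i * \<tau> ! i / s)"
    using \<tau> \<alpha>_nonneg s by (intro prod_ge_1) simp
  have S0_mem: "S0 \<in> ?A"
    using psd_S0 by (simp add: tx_le power_S0 del: of_real_sum)
  have "?f S \<le> ?f S0" if "S \<in> ?A" for S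
  proof -
    have S: "psd_mat (L * N) S" "Re (mtrace (kron (1\<^sub>m L) G * S)) \<le> real N * (\<Sum>i<L. \<alpha> i)"
      using that by (simp_all add: tx_le)
    have le: "Re (det (received S)) \<le> Re (det (received S0))"
      using received_det_le[OF S] \<mu> s by simp
    have "0 \<le> Re (det (received S))"
      by (rule psd_det(1)[OF psd_received[OF S(1)]])
    then consider "Re (det (received S)) = 0" | "0 < Re (det (received S))" by linarith
    then have "log 2 (Re (det (received S)) / Re (det noise)) \<le> log 2 (Re (det (received S0)) / Re (det noise))"
    proof cases
      case 1
      \<comment> \<open>This case never occurs; thanks to \<open>log 2 0 = 0\<close> it need not be excluded.\<close>
      have "1 \<le> Re (det (received S0)) / Re (det noise)"
        unfolding received_S0_det using Omega_pos prod_ge_1 by (simp add: one_le_power)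
      with 1 show ?thesis by (simp add: log_def)
    next
      case 2
      with le Omega_pos show ?thesis by (simp add: divide_right_mono)
    qed
    then show ?thesis
      unfolding Y Omega by (rule mult_left_mono) simp
  qed
  \<comment> \<open>The supremum is a maximum attained at \<open>S0\<close>, which also settles
    boundedness of the set.\<close>
  then have "block_capacity H \<beta> T \<delta> \<sigma>0 P N = ?f S0"
    unfolding block_capacity_def using S0_mem by (intro cSup_eq_maximum) blast+
  also have "\<dots> = 1 / real N * log 2 ((\<Prod>i<L. 1 + \<alpha> i * \<tau> ! i / s) ^ N)"
    unfolding Y Omega received_S0_det using Omega_pos by simp
  also have "\<dots> = log 2 (\<Prod>i<L. 1 + \<alpha> i * \<tau> ! i / s)"
    using N prod_ge_1 by (simp add: log_nat_power)
  also have "\<dots> = (\<Sum>i<L. log 2 (1 + \<alpha> i * \<tau> ! i / s))"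
  proof -
    have "1 + \<alpha> i * \<tau> ! i / s \<noteq> 0" if "i < L" for i
    proof -
      have "0 \<le> \<alpha> i * \<tau> ! i / s"
        using \<tau>[OF that] \<alpha>_nonneg[OF that] s by simp
      then show ?thesis by linarith
    qed
    then show ?thesis
      unfolding log_def by (subst ln_prod) (simp_all add: sum_divide_distrib)
  qed
  also have "\<dots> = (\<Sum>t\<leftarrow>\<tau>. log 2 (1 + (\<sigma>0\<^sup>2 * wf_pos \<mu> t) * t / \<sigma>0\<^sup>2))"
    by (simp add: sum_list_sum_nth len atLeast0LessThan \<alpha>_def s_def)
  finally show ?thesis .
qed

theorem theorem1:
  fixes H :: "complex mat" and K L :: nat and \<beta> T \<delta> \<sigma>0 P \<mu> :: real
    and \<tau> :: "real list"
  assumes "K \<ge> 1" and "L \<ge> 1" and "H \<in> carrier_mat K L"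
    and "0 \<le> \<beta>" and "\<beta> \<le> 1" and "T > 0" and "0 < \<delta>" and "\<delta> \<le> 1"
    and "\<sigma>0\<^sup>2 > 0" and "P > 0"
    and "length \<tau> = L"
    and "char_poly (cadj H * H) = (\<Prod>a\<leftarrow>\<tau>. [:- complex_of_real a, 1:])"
    and "\<mu> > 0"
    and "\<sigma>0\<^sup>2 * (\<Sum>t\<leftarrow>\<tau>. wf_pos \<mu> t) = P * \<delta> * T"
    and "\<delta> * (1 + \<beta>) \<ge> 1"
  shows "((\<lambda>N. block_capacity H \<beta> T \<delta> \<sigma>0 P N)
           \<longlonglongrightarrow> (\<Sum>t\<leftarrow>\<tau>. log 2 (1 + (\<sigma>0\<^sup>2 * wf_pos \<mu> t) * t / \<sigma>0\<^sup>2)))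
         \<and> ((\<lambda>N. block_capacity H \<beta> T \<delta> \<sigma>0 P N / (\<delta> * (1 + \<beta>)))
           \<longlonglongrightarrow> 1 / (\<delta> * (1 + \<beta>)) * (\<Sum>t\<leftarrow>\<tau>. log 2 (1 + (\<sigma>0\<^sup>2 * wf_pos \<mu> t) * t / \<sigma>0\<^sup>2)))"
proof -
  \<comment> \<open>\<open>N = 0\<close> is left out, since \<open>1 / real N\<close> is then a
    division by zero; from \<open>N = 1\<close> on the sequence is constant.\<close>
  have "\<forall>\<^sub>F N in sequentially. (\<Sum>t\<leftarrow>\<tau>. log 2 (1 + (\<sigma>0\<^sup>2 * wf_pos \<mu> t) * t / \<sigma>0\<^sup>2))
      = block_capacity H \<beta> T \<delta> \<sigma>0 P N"
    using eventually_ge_at_top[of 1]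
  proof eventually_elim
    case (elim N)
    show ?case
      using block_capacity_eq[OF assms(3,4,6,7,9,11,12,13,14) elim] by (rule sym)
  qed
  then have lim: "(\<lambda>N. block_capacity H \<beta> T \<delta> \<sigma>0 P N)
      \<longlonglongrightarrow> (\<Sum>t\<leftarrow>\<tau>. log 2 (1 + (\<sigma>0\<^sup>2 * wf_pos \<mu> t) * t / \<sigma>0\<^sup>2))"
    by (rule Lim_transform_eventually[OF tendsto_const])
  then show ?thesis
    using tendsto_mult_left[OF lim, of "1 / (\<delta> * (1 + \<beta>))"] by simp
qed

end
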